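(* Let $q>1$ be real. (i) Let $v:=b_{\ell+1}(y,q)\ldots b_{\ell+m}(y,q)$ for some $y\in[0,1)$ and some integers $\ell\ge0$, $m\ge1$. Then the set $Y_v$ of numbers $x\in J_q$ such that the word $v$ does not occur (as a block of consecutive digits) in the greedy expansion $(b_i(x,q))$ has Hausdorff dimension less than one. (ii) The set $Y$ of numbers $x\in J_q$ for which at least one word of the form $b_{\ell+1}(y,q)\ldots b_{\ell+m}(y,q)$ (with $\ell\ge0$, $m\ge1$, $y\in[0,1)$) does not occur in the greedy expansion of $x$ in base $q$ is of first category, has Lebesgue measure zero and has Hausdorff dimension one.
   Context: For real $q>1$ let $\lceil q\rceil$ be the smallest integer $\ge q$, $A_q=\{0,\ldots,\lceil q\rceil-1\}$ and $J_q=[0,(\lceil q\rceil-1)/(q-1)]$. For $x\in J_q$ the greedy expansion $(b_i(x,q))$ is defined recursively: $b_n(x,q)$ is the largest element of $A_q$ with $\sum_{i=1}^n b_i(x,q)q^{-i}\le x$. *)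

theory Defs
  imports "HOL-Analysis.Analysis"
begin

text \<open>The digit alphabet is A_q = {0,...,ceil q - 1}; we write nq for ceil q as a natural number.\<close>
definition nq :: "real \<Rightarrow> nat" where
  "nq q = nat \<lceil>q\<rceil>"

definition J :: "real \<Rightarrow> real set" where
  "J q = {0 .. (real (nq q) - 1) / (q - 1)}"

definition wval :: "real \<Rightarrow> nat list \<Rightarrow> real" where
  "wval q ds = (\<Sum>i<length ds. real (ds ! i) / q ^ (i + 1))"

fun greedy_prefix :: "real \<Rightarrow> real \<Rightarrow> nat \<Rightarrow> nat list" where
  "greedy_prefix x q 0 = []"
| "greedy_prefix x q (Suc n) =
     (let ps = greedy_prefix x q n
      in ps @ [GREATEST d. d < nq q \<and> wval q (ps @ [d]) \<le> x])"

text \<open>The greedy digit b_n(x,q), indexed from n = 1.\<close>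
definition b :: "nat \<Rightarrow> real \<Rightarrow> real \<Rightarrow> nat" where
  "b n x q = greedy_prefix x q n ! (n - 1)"

definition occurs_in_greedy :: "nat list \<Rightarrow> real \<Rightarrow> real \<Rightarrow> bool" where
  "occurs_in_greedy v x q \<longleftrightarrow> (\<exists>k. \<forall>j<length v. b (k + j + 1) x q = v ! j)"

definition greedy_word :: "real \<Rightarrow> real \<Rightarrow> nat \<Rightarrow> nat \<Rightarrow> nat list" where
  "greedy_word y q l m = map (\<lambda>j. b (l + j + 1) y q) [0..<m]"

definition hausdorff_pre :: "real \<Rightarrow> real \<Rightarrow> real set \<Rightarrow> ennreal" where
  "hausdorff_pre s \<delta> E =
     (INF U \<in> {U :: nat \<Rightarrow> real set. E \<subseteq> (\<Union>i. U i) \<and>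
                 (\<forall>i. bounded (U i) \<and> diameter (U i) \<le> \<delta>)}.
        (\<Sum>i. ennreal (diameter (U i) powr s)))"

definition hausdorff_measure :: "real \<Rightarrow> real set \<Rightarrow> ennreal" where
  "hausdorff_measure s E = (SUP \<delta> \<in> {0<..}. hausdorff_pre s \<delta> E)"

text \<open>For subsets of the real line the set below is nonempty (it contains every s > 1)
  and bounded below by 0, so the infimum is a genuine real number.\<close>
definition hausdorff_dim :: "real set \<Rightarrow> real" where
  "hausdorff_dim E = Inf {s. s > 0 \<and> hausdorff_measure s E = 0}"

definition nowhere_dense :: "real set \<Rightarrow> bool" where
  "nowhere_dense S \<longleftrightarrow> interior (closure S) = {}"

definition first_category :: "real set \<Rightarrow> bool" where
  "first_category S \<longleftrightarrow> (\<exists>F :: nat \<Rightarrow> real set. (\<forall>n. nowhere_dense (F n)) \<and> S \<subseteq> (\<Union>n. F n))"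

end

theory Submission
  imports Defs
begin

text \<open>
  On [0,1) the greedy digits are generated by the expanding map x \<mapsto> qx - digit. Call an interval
  good if the first n digits are constant on it and its image after n steps is an interval [0,c)
  with c \<le> 1. Appending zero digits one may assume c > 1/q; the word 0v then occurs on a
  fixed proportion of the interval, and boundedly many good intervals, of total length at most
  (1 - \<epsilon>) times the original length, cover the rest. For s close to 1 the sum of the s-th powers
  of the lengths therefore shrinks geometrically under iteration, so the set avoiding v has zero
  s-dimensional measure.

  For the lower bound, a good interval has at most one child whose image is not the whole of
  [0,1), so there are at least q^n / (n+1) full intervals of level n. Concatenating words taken
  from every second full interval other than the first gives a self-similar set that avoids a
  long block of zeros. Its coding map has a Hoelder continuous inverse onto [0,1) with exponent s,
  and s can be any number below 1.
\<close>

text \<open>The obstacle is that digit words cannot be concatenated freely when q is not an integer: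
  what may follow a prefix depends on how much of [0,1) the image of its interval covers. For the
  upper bound the digit 0 removes this dependence: an image longer than 1/q contains [0,1/q), which
  one more step maps onto [0,1), so 0v fits behind every prefix padded with zeros. The number M of
  remaining pieces must be bounded uniformly, because passing from first to s-th powers costs up to
  M(1-s). The lower bound uses full intervals since any word occurring in [0,1) may follow them.
  Taking every second one leaves gaps of at least one interval length, which makes the inverse of
  the coding Hoelder; leaving out the first makes every chosen word differ from the zero word. No
  measure is built on the self-similar set: if it were s-null, [0,1) would be Lebesgue null. Points
  of J_q outside [0,1) are caught by intervals that belong to blocks of the largest digit.\<close>

subsection \<open>Null sets of Hausdorff measure\<close>

text \<open>For s > 0 a cover with small sum has small diameters, so no bound on them is imposed.\<close>
definition hnull :: "real \<Rightarrow> real set \<Rightarrow> bool" where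
  "hnull s E \<longleftrightarrow> (\<forall>e>0. \<exists>U :: nat \<Rightarrow> real set. E \<subseteq> (\<Union>i. U i) \<and> (\<forall>i. bounded (U i)) \<and>
     (\<Sum>i. ennreal (diameter (U i) powr s)) \<le> ennreal e)"

lemma hnullE:
  assumes "hnull s E" "0 < e"
  obtains U :: "nat \<Rightarrow> real set" where "E \<subseteq> (\<Union>i. U i)" "\<And>i. bounded (U i)"
    "(\<Sum>i. ennreal (diameter (U i) powr s)) \<le> ennreal e" "\<And>i. diameter (U i) powr s \<le> e"
proof -
  obtain U :: "nat \<Rightarrow> real set" where U: "E \<subseteq> (\<Union>i. U i)" "\<And>i. bounded (U i)"
    "(\<Sum>i. ennreal (diameter (U i) powr s)) \<le> ennreal e"
    using assms unfolding hnull_def by metis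
  have "diameter (U i) powr s \<le> e" for i
  proof -
    have "(\<Sum>j\<in>{i}. ennreal (diameter (U j) powr s)) \<le> (\<Sum>i. ennreal (diameter (U i) powr s))"
      by (rule sum_le_suminf) auto
    also note U(3)
    finally show ?thesis using assms(2) by simp
  qed
  then show thesis by (rule that[OF U])
qed

lemma le_of_powr_le:
  fixes x y s :: real
  assumes "x powr s \<le> y powr s" "0 < s" "0 \<le> x" "0 \<le> y"
  shows "x \<le> y"
  using assms powr_less_mono2[of s y x] by linarith

lemma hausdorff_measure_eq_0_iff:
  assumes "0 < s"
  shows "hausdorff_measure s E = 0 \<longleftrightarrow> hnull s E"
proof
  assume "hausdorff_measure s E = 0"
  then have "hausdorff_pre s 1 E \<le> 0"
    unfolding hausdorff_measure_def by (metis SUP_upper greaterThan_iff zero_less_one)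
  show "hnull s E" unfolding hnull_def
  proof (intro allI impI)
    fix e :: real assume "0 < e"
    then have "hausdorff_pre s 1 E < ennreal e"
      using \<open>hausdorff_pre s 1 E \<le> 0\<close> by (metis ennreal_less_zero_iff order_le_less_trans)
    then show "\<exists>U :: nat \<Rightarrow> real set. E \<subseteq> (\<Union>i. U i) \<and> (\<forall>i. bounded (U i)) \<and>
       (\<Sum>i. ennreal (diameter (U i) powr s)) \<le> ennreal e"
      unfolding hausdorff_pre_def INF_less_iff by (auto intro: less_imp_le)
  qed
next
  assume h: "hnull s E"
  have "hausdorff_pre s \<delta> E \<le> 0" if \<delta>: "0 < \<delta>" for \<delta>
  proof -
    have "hausdorff_pre s \<delta> E \<le> 0 + ennreal e" if e: "0 < e" for e :: real
    proof -
      \<comment> \<open>Each summand is at most the whole sum, so the bound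
        \<open>\<delta> powr s\<close> on the sum forces every diameter below
        \<open>\<delta>\<close>.\<close>
      obtain U :: "nat \<Rightarrow> real set" where U: "E \<subseteq> (\<Union>i. U i)" "\<And>i. bounded (U i)"
        "(\<Sum>i. ennreal (diameter (U i) powr s)) \<le> ennreal (min e (\<delta> powr s))"
        "\<And>i. diameter (U i) powr s \<le> min e (\<delta> powr s)"
        by (rule hnullE[OF h, of "min e (\<delta> powr s)"], use e \<delta> in force) (rule that)
      have "diameter (U i) \<le> \<delta>" for i
        using U(4)[of i] assms \<delta> diameter_ge_0[OF U(2)[of i]] by (auto intro: le_of_powr_le)
      then have "hausdorff_pre s \<delta> E \<le> (\<Sum>i. ennreal (diameter (U i) powr s))"
        unfolding hausdorff_pre_def using U by (intro INF_lower) auto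
      also have "\<dots> \<le> ennreal (min e (\<delta> powr s))" by (rule U)
      also have "\<dots> \<le> 0 + ennreal e" by (simp add: ennreal_leI)
      finally show ?thesis .
    qed
    then show ?thesis by (metis ennreal_le_epsilon)
  qed
  then show "hausdorff_measure s E = 0"
    unfolding hausdorff_measure_def by (intro antisym SUP_least) auto
qed

lemma hnull_subset: "hnull s E \<Longrightarrow> F \<subseteq> E \<Longrightarrow> hnull s F"
  unfolding hnull_def by (meson subset_trans)

text \<open>Once the sum is at most 1, all diameters are at most 1, and raising the exponent only
  shrinks the terms.\<close>

lemma hnull_mono:
  assumes "hnull s E" "0 < s" "s \<le> t"
  shows "hnull t E"
  unfolding hnull_def
proof (intro allI impI)
  fix e :: real assume e: "0 < e"
  obtain U :: "nat \<Rightarrow> real set" where U: "E \<subseteq> (\<Union>i. U i)" "\<And>i. bounded (U i)"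
    "(\<Sum>i. ennreal (diameter (U i) powr s)) \<le> ennreal (min e 1)"
    "\<And>i. diameter (U i) powr s \<le> min e 1"
    by (rule hnullE[OF assms(1), of "min e 1"], simp add: e) (rule that)
  have "diameter (U i) \<le> 1" for i
    using U(4)[of i] assms diameter_ge_0[OF U(2)[of i]] by (auto intro: le_of_powr_le[of _ s])
  then have "diameter (U i) powr t \<le> diameter (U i) powr s" for i
    using assms diameter_ge_0[OF U(2)[of i]] by (intro powr_mono') auto
  then have "(\<Sum>i. ennreal (diameter (U i) powr t)) \<le> (\<Sum>i. ennreal (diameter (U i) powr s))"
    by (intro suminf_le) (auto intro: ennreal_leI)
  also have "\<dots> \<le> ennreal e" using U(3) by (rule order_trans) (simp add: ennreal_leI)
  finally show "\<exists>U :: nat \<Rightarrow> real set. E \<subseteq> (\<Union>i. U i) \<and> (\<forall>i. bounded (U i)) \<and>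
      (\<Sum>i. ennreal (diameter (U i) powr t)) \<le> ennreal e"
    using U by blast
qed

lemma hnull_UN:
  fixes E :: "nat \<Rightarrow> real set"
  assumes "\<And>n. hnull s (E n)"
  shows "hnull s (\<Union>n. E n)"
  unfolding hnull_def
proof (intro allI impI)
  fix e :: real assume e: "0 < e"
  have "\<exists>U :: nat \<Rightarrow> real set. E n \<subseteq> (\<Union>i. U i) \<and> (\<forall>i. bounded (U i)) \<and>
      (\<Sum>i. ennreal (diameter (U i) powr s)) \<le> ennreal (e * (1/2) ^ Suc n)" for n
    using assms[of n] e unfolding hnull_def by simp
  then obtain U :: "nat \<Rightarrow> nat \<Rightarrow> real set" where U: "\<And>n. E n \<subseteq> (\<Union>i. U n i)" "\<And>n i. bounded (U n i)"
      "\<And>n. (\<Sum>i. ennreal (diameter (U n i) powr s)) \<le> ennreal (e * (1/2) ^ Suc n)"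
    by metis
  define V where "V i = (case prod_decode i of (n, k) \<Rightarrow> U n k)" for i
  have "(\<Union>n. E n) \<subseteq> (\<Union>i. V i)"
  proof
    fix x assume "x \<in> (\<Union>n. E n)"
    then obtain n k where "x \<in> U n k" using U(1) by blast
    then have "x \<in> V (prod_encode (n, k))" by (simp add: V_def)
    then show "x \<in> (\<Union>i. V i)" by blast
  qed
  moreover have "bounded (V i)" for i by (simp add: V_def U(2) split: prod.split)
  moreover have "(\<Sum>i. ennreal (diameter (V i) powr s)) \<le> ennreal e"
  proof -
    define f where "f = (\<lambda>(n, k). ennreal (diameter (U n k) powr s))"
    have "ennreal (diameter (V i) powr s) = f (prod_decode i)" for i
      by (simp add: V_def f_def split: prod.split)
    then have "(\<Sum>i. ennreal (diameter (V i) powr s)) = (\<Sum>i. f (prod_decode i))" by presburger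
    also have "\<dots> = (\<Sum>n. \<Sum>k. f (n, k))" by (rule suminf_ennreal_2dimen[OF refl])
    also have "\<dots> = (\<Sum>n. \<Sum>k. ennreal (diameter (U n k) powr s))" by (simp add: f_def)
    also have "\<dots> \<le> (\<Sum>n. ennreal (e * (1/2) ^ Suc n))"
      by (intro suminf_le U) auto
    also have "\<dots> = ennreal e"
      using e sums_mult[OF power_half_series, of e]
      by (subst suminf_ennreal2) (auto simp: sums_iff)
    finally show ?thesis .
  qed
  ultimately show "\<exists>U :: nat \<Rightarrow> real set. (\<Union>n. E n) \<subseteq> (\<Union>i. U i) \<and> (\<forall>i. bounded (U i)) \<and>
      (\<Sum>i. ennreal (diameter (U i) powr s)) \<le> ennreal e"
    by blast
qed

lemma hnull_UN_countable:
  assumes "countable I" "\<And>i. i \<in> I \<Longrightarrow> hnull s (E i)"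
  shows "hnull s (\<Union>i\<in>I. E i)"
proof (cases "I = {}")
  case True
  then show ?thesis unfolding hnull_def by (auto intro: exI[of _ "\<lambda>_. {}"])
next
  case False
  have "hnull s (\<Union>n. E (from_nat_into I n))"
    using assms False by (intro hnull_UN) (simp add: from_nat_into)
  also have "(\<Union>n. E (from_nat_into I n)) = (\<Union>i\<in>I. E i)"
    using range_from_nat_into[OF False assms(1)] by (metis image_image)
  finally show ?thesis .
qed

lemma hnull_finite_cover:
  assumes "\<And>e. 0 < e \<Longrightarrow> \<exists>Us. E \<subseteq> \<Union>(set Us) \<and> (\<forall>U\<in>set Us. bounded U) \<and> (\<Sum>U\<leftarrow>Us. diameter U powr s) \<le> e"
  shows "hnull s E"
  unfolding hnull_def
proof (intro allI impI)
  fix e :: real assume "0 < e"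
  then obtain Us where Us: "E \<subseteq> \<Union>(set Us)" "\<forall>U\<in>set Us. bounded U" "(\<Sum>U\<leftarrow>Us. diameter U powr s) \<le> e"
    using assms by blast
  \<comment> \<open>Empty sets pad the list to a sequence: \<open>diameter {}\<close> is 0 and so is
    \<open>0 powr s\<close>.\<close>
  let ?U = "\<lambda>i. if i < length Us then Us ! i else {}"
  have "E \<subseteq> (\<Union>i. ?U i)"
  proof
    fix x assume "x \<in> E"
    then obtain i where "i < length Us" "x \<in> Us ! i" using Us(1) by (auto simp: set_conv_nth)
    then have "x \<in> ?U i" by simp
    then show "x \<in> (\<Union>i. ?U i)" by blast
  qed
  moreover have "(\<Sum>i. ennreal (diameter (?U i) powr s)) = (\<Sum>i<length Us. ennreal (diameter (?U i) powr s))"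
    by (rule suminf_finite) auto
  moreover have "\<dots> = ennreal (\<Sum>U\<leftarrow>Us. diameter U powr s)"
    by (simp add: sum_list_sum_nth atLeast0LessThan)
  moreover have "\<forall>i. bounded (?U i)" using Us(2) by auto
  ultimately show "\<exists>U :: nat \<Rightarrow> real set. E \<subseteq> (\<Union>i. U i) \<and> (\<forall>i. bounded (U i)) \<and>
      (\<Sum>i. ennreal (diameter (U i) powr s)) \<le> ennreal e"
    using Us(3) by (intro exI[of _ ?U]) (simp add: ennreal_leI)
qed

lemma hnull_singleton: "hnull s {x}"
  by (rule hnull_finite_cover, rule exI[of _ "[{x}]"]) simp

lemma hnull_insert:
  assumes "hnull s A"
  shows "hnull s (insert x A)"
proof -
  have "hnull s (\<Union>B\<in>{{x}, A}. B)"
    by (rule hnull_UN_countable) (use assms hnull_singleton in auto)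
  then show ?thesis by simp
qed

lemma hnull_imp_null_sets:
  assumes "hnull 1 E"
  shows "E \<in> null_sets lebesgue"
proof -
  have "negligible E" unfolding negligible_outer_le
  proof (intro allI impI)
    fix e :: real assume e: "0 < e"
    obtain U :: "nat \<Rightarrow> real set" where U: "E \<subseteq> (\<Union>i. U i)" "\<And>i. bounded (U i)"
      "(\<Sum>i. ennreal (diameter (U i) powr 1)) \<le> ennreal (e / 2)"
      by (rule hnullE[OF assms, of "e / 2"], simp add: e) (rule that)
    \<comment> \<open>An interval about a point of \<open>U i\<close> with radius
      \<open>diameter (U i)\<close> contains \<open>U i\<close>; its length is twice the diameter,
      hence the bound \<open>e / 2\<close> above. For empty \<open>U i\<close> the centre is
      arbitrary.\<close>
    define p where "p i = (SOME x. x \<in> U i)" for i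
    define W where "W i = {p i - diameter (U i) .. p i + diameter (U i)}" for i
    have UW: "U i \<subseteq> W i" for i
    proof
      fix x assume x: "x \<in> U i"
      then have "p i \<in> U i" unfolding p_def by (rule someI)
      then show "x \<in> W i"
        using diameter_bounded_bound[OF U(2) x, of "p i"] by (simp add: W_def dist_real_def abs_le_iff)
    qed
    have "emeasure lebesgue (\<Union>i. W i) \<le> (\<Sum>i. emeasure lebesgue (W i))"
      by (rule emeasure_subadditive_countably) (auto simp: W_def)
    also have "\<dots> = (\<Sum>i. 2 * ennreal (diameter (U i) powr 1))"
      using diameter_ge_0[OF U(2)]
      by (intro suminf_cong) (simp add: W_def ennreal_mult'[of 2, symmetric] flip: ennreal_numeral)
    also have "\<dots> = 2 * (\<Sum>i. ennreal (diameter (U i) powr 1))" by simp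
    also have "\<dots> \<le> 2 * ennreal (e / 2)" by (intro mult_left_mono U) simp
    also have "\<dots> = ennreal e" using e by (simp add: ennreal_mult'[of 2, symmetric] flip: ennreal_numeral)
    finally have le: "emeasure lebesgue (\<Union>i. W i) \<le> ennreal e" .
    have sets: "(\<Union>i. W i) \<in> sets lebesgue" by (auto simp: W_def)
    moreover have "emeasure lebesgue (\<Union>i. W i) < \<infinity>" using le by (simp add: order_le_less_trans)
    ultimately have "(\<Union>i. W i) \<in> lmeasurable" by (simp add: fmeasurableI)
    moreover have "measure lebesgue (\<Union>i. W i) \<le> e"
      unfolding measure_def using le e by (metis enn2real_leI less_imp_le)
    moreover have "E \<subseteq> (\<Union>i. W i)" using U(1) UW by blast
    ultimately show "\<exists>S. E \<subseteq> S \<and> S \<in> lmeasurable \<and> measure lebesgue S \<le> e" by blast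
  qed
  then show ?thesis by (simp add: negligible_iff_null_sets)
qed

section \<open>Bounds on the dimension from null sets\<close>

lemma hausdorff_dim_le:
  assumes "0 < s" "hnull s E"
  shows "hausdorff_dim E \<le> s"
  unfolding hausdorff_dim_def
proof (rule cInf_lower)
  show "bdd_below {s. s > 0 \<and> hausdorff_measure s E = 0}" by (rule bdd_belowI[of _ 0]) simp
qed (use assms hausdorff_measure_eq_0_iff in simp)

text \<open>A lower bound for \<open>Inf\<close> needs a nonempty set; the exponent \<open>s\<close>
  with \<open>hnull s E\<close> is its witness.\<close>

lemma hausdorff_dim_ge:
  assumes "0 < s" "hnull s E" and "\<And>r. 0 < r \<Longrightarrow> hnull r E \<Longrightarrow> t \<le> r"
  shows "t \<le> hausdorff_dim E"
  unfolding hausdorff_dim_def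
proof (rule cInf_greatest)
  show "{s. s > 0 \<and> hausdorff_measure s E = 0} \<noteq> {}"
    using assms(1,2) hausdorff_measure_eq_0_iff by blast
qed (use assms(3) hausdorff_measure_eq_0_iff in blast)

lemma hnull_holder_preimage:
  fixes g :: "real \<Rightarrow> real"
  assumes holder: "\<And>t u. t \<in> S \<Longrightarrow> u \<in> S \<Longrightarrow> \<bar>t - u\<bar> \<le> C * \<bar>g t - g u\<bar> powr s"
    and "0 < C" "0 < s" and null: "hnull s (g ` S)"
  shows "hnull 1 S"
  unfolding hnull_def
proof (intro allI impI)
  fix e :: real assume e: "0 < e"
  obtain U :: "nat \<Rightarrow> real set" where U: "g ` S \<subseteq> (\<Union>i. U i)" "\<And>i. bounded (U i)"
    "(\<Sum>i. ennreal (diameter (U i) powr s)) \<le> ennreal (e / C)"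
    by (rule hnullE[OF null, of "e / C"], simp add: e \<open>0 < C\<close>) (rule that)
  define V where "V i = S \<inter> g -` U i" for i
  have close: "\<bar>t - u\<bar> \<le> C * diameter (U i) powr s" if "t \<in> V i" "u \<in> V i" for i t u
  proof -
    have "\<bar>g t - g u\<bar> powr s \<le> diameter (U i) powr s"
      using diameter_bounded_bound[OF U(2), of "g t" i "g u"] that \<open>0 < s\<close>
      by (intro powr_mono2) (auto simp: V_def dist_real_def)
    then have "C * \<bar>g t - g u\<bar> powr s \<le> C * diameter (U i) powr s" using \<open>0 < C\<close> by simp
    then show ?thesis using holder[of t u] that by (auto simp: V_def intro: order_trans)
  qed
  have diam: "diameter (V i) \<le> C * diameter (U i) powr s" for i
    using close \<open>0 < C\<close> by (intro diameter_le) auto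
  have bdd: "bounded (V i)" for i
    unfolding bounded_two_points using close by (auto simp: dist_real_def)
  have "(\<Sum>i. ennreal (diameter (V i) powr 1)) \<le> (\<Sum>i. ennreal C * ennreal (diameter (U i) powr s))"
    using diam \<open>0 < C\<close> diameter_ge_0[OF bdd]
    by (intro suminf_le) (auto simp: ennreal_mult'[symmetric] intro!: ennreal_leI)
  also have "\<dots> = ennreal C * (\<Sum>i. ennreal (diameter (U i) powr s))" by simp
  also have "\<dots> \<le> ennreal C * ennreal (e / C)" by (intro mult_left_mono U) simp
  also have "\<dots> = ennreal e" using \<open>0 < C\<close> e by (simp add: ennreal_mult'[symmetric])
  finally have "(\<Sum>i. ennreal (diameter (V i) powr 1)) \<le> ennreal e" .
  moreover have "S \<subseteq> (\<Union>i. V i)" using U(1) unfolding V_def by blast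
  ultimately show "\<exists>U :: nat \<Rightarrow> real set. S \<subseteq> (\<Union>i. U i) \<and> (\<forall>i. bounded (U i)) \<and>
      (\<Sum>i. ennreal (diameter (U i) powr 1)) \<le> ennreal e"
    using bdd by blast
qed

text \<open>The left side is concave in \<open>t\<close>, and the right side is its tangent at
  \<open>t = 1\<close>.\<close>

lemma powr_le_tangent:
  fixes t s :: real
  assumes "0 \<le> t" "0 < s" "s < 1"
  shows "t powr s \<le> s * t + (1 - s)"
proof (cases "t = 0")
  case False
  then show ?thesis using Youngs_inequality_0[of s "1 - s" t 1] assms by simp
qed (use assms in simp)

subsection \<open>A separated self-similar set and its coding\<close>

text \<open>\<open>d\<close> and \<open>\<phi>\<close> are the first digit and the shift of the base
  \<open>B\<close> expansion of \<open>t\<close>; \<open>g\<close> reads the same digits in the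
  system of contractions x -> \<open>c j + \<eta> * x\<close>. Each piece has length
  \<open>\<eta>\<close> and, by \<open>gap\<close>, is followed by a hole of length at least
  \<open>\<eta>\<close>. If the first digits of \<open>t\<close> and \<open>u\<close> agree, one
  passes to the shifts, which multiplies the distance by \<open>B\<close> in the source and by
  \<open>1 / \<eta>\<close> in the image; if they differ, the hole already separates the images. The
  bound \<open>c j + 2 * \<eta> \<le> 1\<close> gives
  \<open>g t \<le> (1 - 2 * \<eta>) / (1 - \<eta>) < 1\<close>.\<close>

lemma self_similar_coding:
  fixes c :: "nat \<Rightarrow> real" and B :: nat and \<eta> :: real
  assumes \<eta>: "0 < \<eta>" "\<eta> < 1" and B: "0 < B"
    and c: "\<And>j. j < B \<Longrightarrow> 0 \<le> c j \<and> c j + 2 * \<eta> \<le> 1"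
    and gap: "\<And>i j. i < j \<Longrightarrow> j < B \<Longrightarrow> c i + 2 * \<eta> \<le> c j"
  obtains g \<phi> :: "real \<Rightarrow> real" and d :: "real \<Rightarrow> nat" where
    "\<And>t. 0 \<le> t \<Longrightarrow> t < 1 \<Longrightarrow> 0 \<le> \<phi> t \<and> \<phi> t < 1 \<and> d t < B \<and>
        0 \<le> g t \<and> g t < 1 \<and> g t = c (d t) + \<eta> * g (\<phi> t)"
    "\<And>t u n. 0 \<le> t \<Longrightarrow> t < 1 \<Longrightarrow> 0 \<le> u \<Longrightarrow> u < 1 \<Longrightarrow> 1 / real B ^ n < \<bar>t - u\<bar> \<Longrightarrow>
        \<eta> ^ n \<le> \<bar>g t - g u\<bar>"
proof -
  define d where "d t = nat \<lfloor>real B * t\<rfloor>" for t :: real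
  define \<phi> where "\<phi> t = real B * t - real (d t)" for t :: real
  define f where "f t i = \<eta> ^ i * c (d ((\<phi> ^^ i) t))" for t i
  define g where "g t = (\<Sum>i. f t i)" for t
  have d: "real (d t) \<le> real B * t" "real B * t < real (d t) + 1" if "0 \<le> t" for t
    using that by (simp_all add: d_def)
  have dB: "d t < B" if "0 \<le> t" "t < 1" for t
  proof -
    have "real B * t < real B * 1" using that B by (intro mult_strict_left_mono) auto
    then have "real (d t) < real B" using d(1)[OF that(1)] by linarith
    then show ?thesis by simp
  qed
  have \<phi>: "0 \<le> \<phi> t \<and> \<phi> t < 1" if "0 \<le> t" for t
    using d[OF that] by (simp add: \<phi>_def)
  have \<phi>n: "0 \<le> (\<phi> ^^ i) t \<and> (\<phi> ^^ i) t < 1" if "0 \<le> t" "t < 1" for i t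
    using that \<phi> by (induction i) auto
  have f: "0 \<le> f t i \<and> f t i \<le> (1 - 2 * \<eta>) * \<eta> ^ i" if "0 \<le> t" "t < 1" for t i
  proof -
    have "0 \<le> c (d ((\<phi> ^^ i) t)) \<and> c (d ((\<phi> ^^ i) t)) + 2 * \<eta> \<le> 1"
      using c dB \<phi>n that by blast
    then have *: "0 \<le> c (d ((\<phi> ^^ i) t))" "c (d ((\<phi> ^^ i) t)) \<le> 1 - 2 * \<eta>" by linarith+
    then have "\<eta> ^ i * c (d ((\<phi> ^^ i) t)) \<le> \<eta> ^ i * (1 - 2 * \<eta>)" using \<eta> by (intro mult_left_mono) auto
    then show ?thesis using * \<eta> by (simp add: f_def mult.commute)
  qed
  have geo: "(\<lambda>i. (1 - 2 * \<eta>) * \<eta> ^ i) sums ((1 - 2 * \<eta>) * (1 / (1 - \<eta>)))"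
    using \<eta> by (intro sums_mult geometric_sums) auto
  have summ: "summable (f t)" if "0 \<le> t" "t < 1" for t
    by (rule summable_comparison_test'[OF sums_summable[OF geo], of 0]) (use f[OF that] in auto)
  have g_nonneg: "0 \<le> g t" if "0 \<le> t" "t < 1" for t
    unfolding g_def using f[OF that] summ[OF that] by (intro suminf_nonneg) auto
  have g_less: "g t < 1" if "0 \<le> t" "t < 1" for t
  proof -
    have "g t \<le> (1 - 2 * \<eta>) * (1 / (1 - \<eta>))"
      unfolding g_def by (rule suminf_le[OF _ summ[OF that] sums_summable[OF geo], unfolded sums_unique[OF geo, symmetric]])
        (use f[OF that] in auto)
    also have "\<dots> < 1" using \<eta> by (simp add: divide_less_eq)
    finally show ?thesis .
  qed
  have g_rec: "g t = c (d t) + \<eta> * g (\<phi> t)" if "0 \<le> t" "t < 1" for t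
  proof -
    have "f t (Suc i) = \<eta> * f (\<phi> t) i" for i by (simp add: f_def funpow_swap1)
    then have "(\<Sum>i. f t (Suc i)) = \<eta> * g (\<phi> t)"
      using suminf_mult[OF summ[of "\<phi> t"], of \<eta>] \<phi>[OF that(1)] by (simp add: g_def)
    moreover have "f t 0 = c (d t)" by (simp add: f_def)
    ultimately show ?thesis using suminf_split_head[OF summ[OF that]] by (simp only: g_def)
  qed
  have sep: "\<eta> ^ n \<le> \<bar>g t - g u\<bar>" if "0 \<le> t" "t < 1" "0 \<le> u" "u < 1" "1 / real B ^ n < \<bar>t - u\<bar>" for t u n
    using that
  proof (induction n arbitrary: t u)
    case (Suc n)
    define D where "D = g (\<phi> t) - g (\<phi> u)"
    have D: "\<bar>D\<bar> < 1"
      using \<phi> g_nonneg g_less Suc.prems unfolding D_def by (smt (verit))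
    have g_diff: "g t - g u = c (d t) - c (d u) + \<eta> * D"
      using g_rec Suc.prems by (simp add: D_def algebra_simps)
    show ?case
    proof (cases "d t = d u")
      case True
      then have "\<phi> t - \<phi> u = real B * (t - u)" by (simp add: \<phi>_def algebra_simps)
      then have "\<bar>\<phi> t - \<phi> u\<bar> = real B * \<bar>t - u\<bar>" by (simp add: abs_mult)
      moreover have "1 / real B ^ n < real B * \<bar>t - u\<bar>" using Suc.prems(5) B by (simp add: field_simps)
      ultimately have "\<eta> ^ n \<le> \<bar>D\<bar>" unfolding D_def using \<phi> Suc.prems by (intro Suc.IH) auto
      then have "\<eta> * \<eta> ^ n \<le> \<eta> * \<bar>D\<bar>" using \<eta> by (intro mult_left_mono) auto
      then show ?thesis using g_diff True \<eta> by (simp add: abs_mult)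
    next
      case False
      have "\<bar>\<eta> * D\<bar> \<le> \<eta> * 1" unfolding abs_mult using \<eta> D by (intro mult_mono) auto
      moreover have "2 * \<eta> \<le> \<bar>c (d t) - c (d u)\<bar>"
        using False gap[of "d t" "d u"] gap[of "d u" "d t"] dB Suc.prems by (cases "d t < d u") force+
      ultimately have "\<eta> \<le> \<bar>g t - g u\<bar>" using g_diff by linarith
      moreover have "\<eta> ^ Suc n \<le> \<eta>" using \<eta> power_decreasing[of 1 "Suc n" \<eta>] by simp
      ultimately show ?thesis by linarith
    qed
  qed simp
  show thesis using that[of \<phi> d g] \<phi> dB g_nonneg g_less g_rec sep by blast
qed

text \<open>Take the least \<open>n\<close> with \<open>1 / B ^ n < \<bar>t - u\<bar>\<close>. It is
  positive since the distance is below 1, so minimality bounds the distance by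
  \<open>1 / B ^ (n - 1)\<close>. The lost level is the factor \<open>B\<close>, and
  \<open>1 / B \<le> \<eta> powr s\<close> compares the remaining \<open>n\<close> levels with
  \<open>(\<eta> ^ n) powr s\<close>.\<close>

lemma inverse_holder:
  fixes g :: "real \<Rightarrow> real"
  assumes sep: "\<And>n. 1 / real B ^ n < \<bar>t - u\<bar> \<Longrightarrow> \<eta> ^ n \<le> \<bar>g t - g u\<bar>"
    and "0 < \<eta>" "0 < s" "1 < B" "1 / real B \<le> \<eta> powr s" "\<bar>t - u\<bar> < 1"
  shows "\<bar>t - u\<bar> \<le> real B * \<bar>g t - g u\<bar> powr s"
proof (cases "t = u")
  case False
  have "1 / \<bar>t - u\<bar> < real B ^ n \<longleftrightarrow> 1 / real B ^ n < \<bar>t - u\<bar>" for n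
    using False \<open>1 < B\<close> by (simp add: field_simps)
  then have ex: "\<exists>n. 1 / real B ^ n < \<bar>t - u\<bar>"
    using real_arch_pow[of "real B" "1 / \<bar>t - u\<bar>"] \<open>1 < B\<close> by auto
  define n where "n = (LEAST n. 1 / real B ^ n < \<bar>t - u\<bar>)"
  have n: "1 / real B ^ n < \<bar>t - u\<bar>" unfolding n_def using ex by (rule LeastI_ex)
  then obtain k where k: "n = Suc k" using assms(6) by (cases n) auto
  then have "k < (LEAST n. 1 / real B ^ n < \<bar>t - u\<bar>)" by (simp add: n_def)
  then have "\<bar>t - u\<bar> \<le> 1 / real B ^ k" using not_less_Least not_le by blast
  also have "\<dots> = real B * (1 / real B) ^ n" using \<open>1 < B\<close> by (simp add: k power_one_over)
  also have "\<dots> \<le> real B * (\<eta> powr s) ^ n"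
    using assms(5) by (intro mult_left_mono power_mono) auto
  also have "(\<eta> powr s) ^ n = (\<eta> ^ n) powr s"
    using \<open>0 < \<eta>\<close> by (simp add: powr_powr powr_power mult.commute flip: powr_realpow)
  also have "real B * \<dots> \<le> real B * \<bar>g t - g u\<bar> powr s"
    using sep[OF n] assms by (intro mult_left_mono powr_mono2) auto
  finally show ?thesis .
qed simp

subsection \<open>Greedy digits as an expanding map\<close>

lemma wval_Nil [simp]: "wval q [] = 0"
  by (simp add: wval_def)

lemma wval_snoc: "wval q (ps @ [d]) = wval q ps + real d / q ^ Suc (length ps)"
  by (simp add: wval_def nth_append)

lemma wval_append: "wval q (ps @ rs) = wval q ps + wval q rs / q ^ length ps"
proof (induction rs rule: rev_induct)
  case (snoc d rs)
  show ?case
    unfolding append_assoc[symmetric] wval_snoc snoc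
    by (simp add: power_add add_divide_distrib)
qed simp

lemma wval_single [simp]: "wval q [d] = real d / q"
  by (simp add: wval_def)

lemma wval_zeros [simp]: "wval q (replicate n 0) = 0"
  by (simp add: wval_def)

locale greedy_base =
  fixes q :: real
  assumes q1: "1 < q"
begin

definition N :: nat where "N = nq q - 1"

text \<open>The cap makes \<open>dig\<close> agree with the greedy choice on the part of
  \<open>J q\<close> beyond 1, where the floor can exceed the largest digit
  \<open>N\<close>.\<close>

definition dig :: "real \<Rightarrow> nat" where "dig r = min N (nat \<lfloor>q * r\<rfloor>)"

text \<open>On [0,1) this is the beta-transformation r -> qr mod 1.\<close>

definition T :: "real \<Rightarrow> real" where "T r = q * r - real (dig r)"

definition word :: "nat \<Rightarrow> real \<Rightarrow> nat list" where
  "word n x = map (\<lambda>i. dig ((T ^^ i) x)) [0..<n]"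

lemma nq_eq: "nq q = Suc N" and N_less: "real N < q" and N_ge: "q \<le> real N + 1"
proof -
  have c: "\<lceil>q\<rceil> \<ge> 2" using q1 by linarith
  have r: "real (nq q) = of_int \<lceil>q\<rceil>" unfolding nq_def using c by simp
  show 1: "nq q = Suc N" using c unfolding N_def nq_def by linarith
  show "real N < q" "q \<le> real N + 1" using 1 r by linarith+
qed

lemma q_pos [simp]: "0 < q" "0 \<le> q" "q \<noteq> 0" "\<not> q < 0" using q1 by auto

lemma T_nonneg: "0 \<le> r \<Longrightarrow> 0 \<le> T r"
proof -
  assume r: "0 \<le> r"
  have "real (dig r) \<le> real (nat \<lfloor>q * r\<rfloor>)" by (simp add: dig_def)
  also have "\<dots> = of_int \<lfloor>q * r\<rfloor>" using r by simp
  finally have "real (dig r) \<le> of_int \<lfloor>q * r\<rfloor>" .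
  then show ?thesis unfolding T_def by linarith
qed

lemma Tn_nonneg: "0 \<le> x \<Longrightarrow> 0 \<le> (T ^^ n) x"
  by (induction n) (auto simp: T_nonneg)

lemma T_less_1:
  assumes "0 \<le> r" "r < 1" shows "T r < 1"
proof -
  have "q * r < q" using assms by simp
  then have "\<lfloor>q * r\<rfloor> \<le> int N" using N_ge by linarith
  then have "dig r = nat \<lfloor>q * r\<rfloor>" by (simp add: dig_def)
  then show ?thesis unfolding T_def using assms by (simp, linarith)
qed

lemma Tn_less_1: "0 \<le> x \<Longrightarrow> x < 1 \<Longrightarrow> (T ^^ n) x < 1"
  by (induction n) (auto simp: T_less_1 Tn_nonneg)

lemma length_word [simp]: "length (word n x) = n"
  by (simp add: word_def)

lemma word_0 [simp]: "word 0 x = []" by (simp add: word_def)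

lemma word_Suc: "word (Suc n) x = word n x @ [dig ((T ^^ n) x)]"
  by (simp add: word_def)

lemma word_Tn: "word m ((T ^^ k) x) = map (\<lambda>i. dig ((T ^^ (k + i)) x)) [0..<m]"
  unfolding word_def add.commute[of k] by (simp add: funpow_add)

lemma word_add: "word (n + k) x = word n x @ word k ((T ^^ n) x)"
  unfolding word_Tn by (induction k) (simp_all add: word_Suc)

lemma Tn_eq: "(T ^^ n) x = q ^ n * (x - wval q (word n x))"
proof (induction n)
  case (Suc n)
  have "(T ^^ Suc n) x = q * (T ^^ n) x - real (dig ((T ^^ n) x))"
    by (simp only: funpow.simps o_apply T_def)
  also have "\<dots> = q ^ Suc n * (x - wval q (word (Suc n) x))"
    unfolding word_Suc wval_snoc length_word Suc by (simp add: right_diff_distrib distrib_left)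
  finally show ?case .
qed simp

text \<open>After multiplication by a power of \<open>q\<close> the condition on \<open>d\<close>
  reads \<open>d \<le> q * r\<close> for the rescaled remainder \<open>r\<close>, so the largest
  admissible digit is the smaller of \<open>N\<close> and the floor of \<open>q * r\<close>.\<close>

lemma GREATEST_digit:
  assumes "wval q ps \<le> x"
  shows "(GREATEST d. d < nq q \<and> wval q (ps @ [d]) \<le> x) = dig (q ^ length ps * (x - wval q ps))"
proof -
  define r where "r = q ^ length ps * (x - wval q ps)"
  have r0: "0 \<le> r" using assms by (simp add: r_def)
  have iff: "wval q (ps @ [d]) \<le> x \<longleftrightarrow> d \<le> nat \<lfloor>q * r\<rfloor>" for d
  proof -
    have "wval q (ps @ [d]) \<le> x \<longleftrightarrow> real d \<le> q * r"
      by (simp add: wval_append r_def field_simps)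
    also have "\<dots> \<longleftrightarrow> d \<le> nat \<lfloor>q * r\<rfloor>"
      using r0 by (simp add: le_nat_iff le_floor_iff)
    finally show ?thesis .
  qed
  show ?thesis unfolding iff r_def[symmetric] nq_eq dig_def
    by (rule Greatest_equality) auto
qed

lemma greedy_prefix_eq: "0 \<le> x \<Longrightarrow> greedy_prefix x q n = word n x"
proof (induction n)
  case (Suc n)
  have "0 \<le> q ^ n * (x - wval q (word n x))"
    using Tn_nonneg[OF Suc.prems, of n] by (simp only: Tn_eq)
  then have "wval q (word n x) \<le> x" using zero_less_power[OF q_pos(1), of n] by (simp add: zero_le_mult_iff)
  from GREATEST_digit[OF this] show ?case
    using Suc by (simp add: Let_def word_Suc Tn_eq)
qed simp

lemma b_eq: "0 \<le> x \<Longrightarrow> b (Suc i) x q = dig ((T ^^ i) x)"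
  by (simp add: b_def greedy_prefix_eq word_Suc nth_append del: greedy_prefix.simps)

lemma occurs_iff:
  assumes "0 \<le> x"
  shows "occurs_in_greedy v x q \<longleftrightarrow> (\<exists>k. word (length v) ((T ^^ k) x) = v)"
  unfolding occurs_in_greedy_def word_Tn list_eq_iff_nth_eq using b_eq[OF assms] by simp

lemma greedy_word_eq: "0 \<le> y \<Longrightarrow> greedy_word y q l m = word m ((T ^^ l) y)"
  unfolding greedy_word_def word_Tn using b_eq by simp

subsection \<open>Intervals with a common digit prefix\<close>

definition cyl :: "nat list \<Rightarrow> real \<Rightarrow> real set" where
  "cyl p w = {wval q p ..< wval q p + w}"

text \<open>Only one inclusion is asked for: other points may have prefix \<open>p\<close> as well.
  The bound on \<open>w\<close> says that the image after \<open>length p\<close> steps stays in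
  [0,1). Width 0 gives an empty interval, so that children of width 0 count as good.\<close>

definition good :: "nat list \<Rightarrow> real \<Rightarrow> bool" where
  "good p w \<longleftrightarrow> 0 \<le> w \<and> q ^ length p * w \<le> 1 \<and> (\<forall>x\<in>cyl p w. word (length p) x = p)"

lemma wval_nonneg: "0 \<le> wval q p"
  unfolding wval_def by (intro sum_nonneg) simp

lemma cyl_nonneg: "x \<in> cyl p w \<Longrightarrow> 0 \<le> x"
  using wval_nonneg[of p] by (auto simp: cyl_def)

lemma good_nonneg: "good p w \<Longrightarrow> 0 \<le> w" by (simp add: good_def)

lemma good_0 [simp]: "good p 0" by (simp add: good_def cyl_def)

lemma good_Nil: "0 \<le> w \<Longrightarrow> w \<le> 1 \<Longrightarrow> good [] w" by (simp add: good_def)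

lemma good_Tn: "good p w \<Longrightarrow> x \<in> cyl p w \<Longrightarrow> (T ^^ length p) x = q ^ length p * (x - wval q p)"
  by (simp add: good_def Tn_eq)

lemma good_single:
  assumes "d \<le> N" "0 \<le> w" "q * w \<le> 1" shows "good [d] w"
proof -
  have "dig x = d" if "x \<in> cyl [d] w" for x
  proof -
    have "real d / q \<le> x" "x < real d / q + w" using that by (auto simp: cyl_def)
    then have "real d \<le> q * x" "q * x < real d + q * w" by (auto simp: field_simps)
    then have "\<lfloor>q * x\<rfloor> = int d" using assms(3) by linarith
    then show ?thesis using assms by (simp add: dig_def)
  qed
  then show ?thesis using assms by (simp add: good_def word_def)
qed

lemma cyl_append_subset:
  assumes "wval q r + v \<le> q ^ length p * w"
  shows "cyl (p @ r) (v / q ^ length p) \<subseteq> cyl p w"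
proof
  fix x assume "x \<in> cyl (p @ r) (v / q ^ length p)"
  then have x: "wval q p + wval q r / q ^ length p \<le> x"
      "x < wval q p + (wval q r + v) / q ^ length p"
    by (auto simp: cyl_def wval_append add_divide_distrib)
  have "(wval q r + v) / q ^ length p \<le> w" using assms by (simp add: field_simps)
  moreover have "0 \<le> wval q r / q ^ length p" using wval_nonneg by simp
  ultimately show "x \<in> cyl p w" using x by (auto simp: cyl_def)
qed

text \<open>\<open>T ^^ length p\<close> maps \<open>cyl p w\<close> affinely onto
  \<open>[0, q ^ length p * w)\<close>. The third assumption puts \<open>cyl r v\<close> inside this
  image, and the new interval is its preimage.\<close>

lemma good_append:
  assumes "good p w" "good r v" "wval q r + v \<le> q ^ length p * w"
  shows "good (p @ r) (v / q ^ length p)"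
proof -
  have "word (length p + length r) x = p @ r" if x: "x \<in> cyl (p @ r) (v / q ^ length p)" for x
  proof -
    have xp: "x \<in> cyl p w" using cyl_append_subset[OF assms(3)] x by blast
    have "q ^ length p * (x - wval q p) \<in> cyl r v"
      using x by (auto simp: cyl_def wval_append field_simps)
    then have "(T ^^ length p) x \<in> cyl r v" using good_Tn[OF assms(1) xp] by simp
    then show ?thesis using assms xp by (simp add: word_add good_def)
  qed
  moreover have "q ^ length (p @ r) * (v / q ^ length p) \<le> 1"
    using assms(2) by (simp add: good_def power_add)
  ultimately show ?thesis using assms(2) by (simp add: good_def)
qed

text \<open>In an interval of level \<open>n\<close> and width \<open>w\<close>, the child with
  digit \<open>d\<close> starts at distance \<open>d / q ^ Suc n\<close> from the left end. The
  minimum cuts it off at the right end of the parent, and the maximum turns children that would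
  start beyond that end into empty ones.\<close>

definition child_width :: "nat \<Rightarrow> real \<Rightarrow> nat \<Rightarrow> real" where
  "child_width n w d = max 0 (min (1 / q ^ Suc n) (w - real d / q ^ Suc n))"

lemma good_child:
  assumes "good p w" "d \<le> N"
  shows "good (p @ [d]) (child_width (length p) w d)"
proof (cases "child_width (length p) w d \<le> 0")
  case True
  then have "child_width (length p) w d = 0" by (simp add: child_width_def)
  then show ?thesis by simp
next
  case False
  define c where "c = child_width (length p) w d"
  have c: "0 < c" "c \<le> 1 / q ^ Suc (length p)" "c \<le> w - real d / q ^ Suc (length p)"
    using False by (auto simp: child_width_def c_def)
  have "good [d] (q ^ length p * c)"
    using c assms by (intro good_single) (auto simp: field_simps)
  moreover have "wval q [d] + q ^ length p * c \<le> q ^ length p * w"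
    using c(3) by (simp add: field_simps)
  ultimately have "good (p @ [d]) (q ^ length p * c / q ^ length p)"
    using good_append assms by blast
  then show ?thesis by (simp add: c_def)
qed

lemma good_mult_less: "good p w \<Longrightarrow> w * q ^ Suc (length p) \<le> q"
  by (simp add: good_def mult.commute mult.left_commute)

lemma cyl_children:
  assumes "good p w" "x \<in> cyl p w"
  shows "\<exists>d\<le>N. x \<in> cyl (p @ [d]) (child_width (length p) w d)"
proof -
  define \<delta> where "\<delta> = 1 / q ^ Suc (length p)"
  have \<delta>: "0 < \<delta>" by (simp add: \<delta>_def)
  define y where "y = (x - wval q p) / \<delta>"
  have y0: "0 \<le> y" using assms(2) \<delta> by (simp add: y_def cyl_def)
  have "y < w / \<delta>" using assms(2) \<delta> by (simp add: y_def cyl_def divide_strict_right_mono)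
  \<comment> \<open>In units of a full child the parent is at most \<open>q \<le> N + 1\<close>
    long, so no digit above \<open>N\<close> is called for.\<close>
  also have "w / \<delta> \<le> q" using good_mult_less[OF assms(1)] by (simp add: \<delta>_def)
  finally have "y < real N + 1" using N_ge by linarith
  define d where "d = nat \<lfloor>y\<rfloor>"
  have d: "real d \<le> y" "y < real d + 1" using y0 by (simp_all add: d_def)
  have "d \<le> N" using \<open>y < real N + 1\<close> d by linarith
  have x: "x = wval q p + y * \<delta>" using \<delta> by (simp add: y_def)
  have "real d * \<delta> \<le> y * \<delta>" "y * \<delta> < (real d + 1) * \<delta>" using d \<delta> by simp_all
  moreover have "child_width (length p) w d = max 0 (min \<delta> (w - real d * \<delta>))"
      "wval q (p @ [d]) = wval q p + real d * \<delta>"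
    by (simp_all add: child_width_def wval_snoc \<delta>_def)
  ultimately have "x \<in> cyl (p @ [d]) (child_width (length p) w d)"
    using x assms(2) by (simp add: cyl_def distrib_right) linarith
  then show ?thesis using \<open>d \<le> N\<close> by blast
qed

lemma sum_child_width:
  assumes "good p w"
  shows "(\<Sum>d<Suc N. child_width (length p) w d) = w"
proof -
  define \<delta> where "\<delta> = 1 / q ^ Suc (length p)"
  have \<delta>: "0 < \<delta>" by (simp add: \<delta>_def)
  \<comment> \<open>The children fill the parent from the left, so the first \<open>k\<close> cover
    \<open>k * \<delta>\<close> until the whole width is used up.\<close>
  have "(\<Sum>d<k. child_width (length p) w d) = min w (real k * \<delta>)" for k
  proof (induction k)
    case (Suc k)
    have "child_width (length p) w k = max 0 (min \<delta> (w - real k * \<delta>))"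
      by (simp add: child_width_def \<delta>_def)
    then show ?case using Suc \<delta> by (auto simp: algebra_simps)
  qed (use good_nonneg[OF assms] in simp)
  moreover have "w \<le> real (Suc N) * \<delta>"
  proof -
    have "w * q ^ Suc (length p) \<le> real (Suc N)"
      using order_trans[OF good_mult_less[OF assms] N_ge] by (simp del: power_Suc)
    then show ?thesis by (simp add: \<delta>_def pos_le_divide_eq del: power_Suc of_nat_Suc)
  qed
  ultimately show ?thesis by (simp only: min_absorb1)
qed

text \<open>While \<open>q ^ Suc (length p) * w \<le> 1\<close>, every point of the interval has
  next digit 0, so a zero can be appended without changing the interval. Its image grows by the
  factor \<open>q\<close> each time; stopping as soon as the image is longer than 1/q keeps it
  within [0,1).\<close>

lemma good_normalise:
  assumes "good p w" "0 < w"
  obtains p' where "wval q p' = wval q p" "good p' w" "1 < q ^ Suc (length p') * w"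
proof -
  obtain n where "1 / w < q ^ n" using real_arch_pow[OF q1] by blast
  then have "1 < q ^ n * w" using assms by (simp add: field_simps)
  also have "\<dots> \<le> q ^ (length p + n + 1) * w"
    using assms q1 by (intro mult_right_mono power_increasing) auto
  finally have ex: "\<exists>j. 1 < q ^ (length p + j + 1) * w" by blast
  define j where "j = (LEAST j. 1 < q ^ (length p + j + 1) * w)"
  have j: "1 < q ^ (length p + j + 1) * w" unfolding j_def using ex by (rule LeastI_ex)
  have "good (p @ replicate i 0) w" if "i \<le> j" for i
    using that
  proof (induction i)
    case (Suc i)
    then have "i < (LEAST j. 1 < q ^ (length p + j + 1) * w)" by (simp add: j_def)
    then have "q ^ (length p + i + 1) * w \<le> 1" using not_less_Least not_le by blast
    then have "good [0] (q ^ (length p + i) * w)"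
      using assms by (intro good_single) auto
    then have "good ((p @ replicate i 0) @ [0]) (q ^ (length p + i) * w / q ^ length (p @ replicate i 0))"
      using Suc by (intro good_append[where w = w]) auto
    then show ?case by (simp add: replicate_append_same)
  qed (use assms in simp)
  from this[of j] j show thesis by (intro that[of "p @ replicate j 0"]) (auto simp: wval_append)
qed

text \<open>At each level the interval around \<open>z\<close> is split into its children; the child
  with \<open>z\<close> is carried on and its siblings join \<open>L\<close>. The length bound
  records that \<open>L\<close> misses at least \<open>w0\<close> of [0,1).\<close>

lemma cylinder_partition:
  assumes "0 \<le> z" "z < 1"
  shows "\<exists>w0 L. good (word m z) w0 \<and> wval q (word m z) + w0 \<le> 1 \<and> z \<in> cyl (word m z) w0 \<and>
    (\<forall>(p, w)\<in>set L. good p w \<and> wval q p + w \<le> 1) \<and>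
    {0..<1} \<subseteq> cyl (word m z) w0 \<union> (\<Union>(p, w)\<in>set L. cyl p w) \<and> (\<Sum>(p, w)\<leftarrow>L. w) + w0 \<le> 1"
proof (induction m)
  case 0
  show ?case by (rule exI[of _ 1], rule exI[of _ "[]"]) (use assms in \<open>auto simp: good_Nil cyl_def\<close>)
next
  case (Suc m)
  define v where "v = word m z"
  obtain w0 L where IH: "good v w0" "wval q v + w0 \<le> 1" "z \<in> cyl v w0"
    "\<forall>(p, w)\<in>set L. good p w \<and> wval q p + w \<le> 1"
    "{0..<1} \<subseteq> cyl v w0 \<union> (\<Union>(p, w)\<in>set L. cyl p w)" "(\<Sum>(p, w)\<leftarrow>L. w) + w0 \<le> 1"
    using Suc unfolding v_def by blast
  define c where "c d = child_width (length v) w0 d" for d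
  obtain d0 where d0: "d0 \<le> N" "z \<in> cyl (v @ [d0]) (c d0)"
    using cyl_children[OF IH(1,3)] unfolding c_def by blast
  have g: "good (v @ [d]) (c d)" if "d \<le> N" for d using good_child[OF IH(1) that] by (simp add: c_def)
  have le: "wval q (v @ [d]) + c d \<le> 1" if "0 < c d" for d
    using that IH(2) by (auto simp: c_def child_width_def wval_snoc)
  have word: "word (Suc m) z = v @ [d0]"
    using g[OF d0(1)] d0(2) by (simp add: good_def v_def)
  \<comment> \<open>Empty children are filtered out: their left ends may lie beyond 1, which would
    violate \<open>wval q p + w \<le> 1\<close>.\<close>
  define L' where "L' = L @ map (\<lambda>d. (v @ [d], c d)) (filter (\<lambda>d. 0 < c d) (remove1 d0 [0..<Suc N]))"
  have pos: "0 < c d0" using d0 by (auto simp: cyl_def)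
  have cpos: "0 \<le> c d" for d by (simp add: c_def child_width_def)
  have "(\<Sum>d\<leftarrow>filter (\<lambda>d. 0 < c d) (remove1 d0 [0..<Suc N]). c d) = (\<Sum>d\<leftarrow>remove1 d0 [0..<Suc N]. c d)"
    using cpos by (intro sum_list_map_filter) (auto simp: order_le_less)
  moreover have "c d0 + (\<Sum>d\<leftarrow>remove1 d0 [0..<Suc N]. c d) = (\<Sum>d\<leftarrow>[0..<Suc N]. c d)"
    using d0(1) by (subst sum_list_map_remove1[of d0 "[0..<Suc N]"]) auto
  moreover have "\<dots> = w0" using sum_child_width[OF IH(1)]
    by (simp only: c_def interv_sum_list_conv_sum_set_nat atLeast0LessThan set_upt)
  ultimately have "(\<Sum>(p, w)\<leftarrow>L'. w) + c d0 \<le> 1"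
    using IH(6) by (simp add: L'_def comp_def case_prod_unfold)
  moreover have "{0..<1} \<subseteq> cyl (v @ [d0]) (c d0) \<union> (\<Union>(p, w)\<in>set L'. cyl p w)"
  proof
    fix x :: real assume "x \<in> {0..<1}"
    then consider "x \<in> cyl v w0" | "x \<in> (\<Union>(p, w)\<in>set L. cyl p w)" using IH(5) by blast
    then show "x \<in> cyl (v @ [d0]) (c d0) \<union> (\<Union>(p, w)\<in>set L'. cyl p w)"
    proof cases
      case 1
      then obtain d where d: "d \<le> N" "x \<in> cyl (v @ [d]) (c d)"
        using cyl_children[OF IH(1)] unfolding c_def by blast
      moreover have "0 < c d" using d by (auto simp: cyl_def)
      ultimately have "d = d0 \<or> (v @ [d], c d) \<in> set L'" by (auto simp: L'_def)
      then show ?thesis using d by blast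
    qed (auto simp: L'_def)
  qed
  moreover have "\<forall>(p, w)\<in>set L'. good p w \<and> wval q p + w \<le> 1"
    using IH(4) g le by (auto simp: L'_def)
  ultimately show ?case unfolding word using g[OF d0(1)] d0 le[OF pos] by blast
qed

lemma occurs_in_cyl:
  assumes "good (p @ r) w" "x \<in> cyl (p @ r) w"
  shows "occurs_in_greedy r x q"
proof -
  have "word (length p + length r) x = p @ r" using assms by (simp add: good_def)
  then have "word (length r) ((T ^^ length p) x) = r" by (simp add: word_add)
  then show ?thesis using occurs_iff cyl_nonneg[OF assms(2)] by blast
qed

subsection \<open>Points avoiding a word\<close>

text \<open>After normalisation the image contains [0,1/q), the interval of the digit 0. Since the
  interval of \<open>word m z\<close> lies in [0,1), its copy behind the digit 0 lies in [0,1/q) and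
  can be pulled back along \<open>p'\<close>.\<close>

lemma good_subcyl:
  assumes "good (word m z) v" "0 < v" "wval q (word m z) + v \<le> 1" "good p w" "0 < w"
  obtains p' where "good (p' @ 0 # word m z) (v / q ^ Suc (length p'))" "wval q p' = wval q p"
    "good p' w" "1 < q ^ Suc (length p') * w"
    "cyl (p' @ 0 # word m z) (v / q ^ Suc (length p')) \<subseteq> cyl p w"
proof -
  obtain p' where p': "wval q p' = wval q p" "good p' w" "1 < q ^ Suc (length p') * w"
    using good_normalise[OF assms(4,5)] by blast
  have "good [0] (1 / q)" by (intro good_single) auto
  then have "good ([0] @ word m z) (v / q)"
    using good_append[OF _ assms(1), of "[0]" "1 / q"] assms(3) by simp
  moreover have le: "wval q (0 # word m z) + v / q \<le> q ^ length p' * w"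
    using p'(3) assms(3) wval_append[of q "[0]" "word m z"] by (simp add: field_simps)
  ultimately have "good (p' @ 0 # word m z) (v / q / q ^ length p')"
    using good_append[OF p'(2), of "0 # word m z" "v / q"] by simp
  moreover have "cyl (p' @ 0 # word m z) (v / q / q ^ length p') \<subseteq> cyl p w"
    using cyl_append_subset[OF le] p'(1) by (simp add: cyl_def)
  ultimately show thesis using that p' by (simp add: field_simps)
qed

text \<open>\<open>M\<close> and \<open>\<epsilon>\<close> are independent of \<open>p\<close> and
  \<open>w\<close>. The cover consists of the children with nonzero digit and, inside the full child
  with digit 0, a scaled copy of the partition of [0,1) from which the interval of the word is left
  out.\<close>

lemma avoiding_cover_step:
  assumes "0 \<le> z" "z < 1"
  obtains M \<epsilon> where "0 < \<epsilon>" "\<epsilon> < 1"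
    "\<And>p w. good p w \<Longrightarrow> \<exists>L. length L \<le> M \<and> (\<forall>(r, u)\<in>set L. good r u) \<and>
       {x \<in> cyl p w. \<not> occurs_in_greedy (word m z) x q} \<subseteq> (\<Union>(r, u)\<in>set L. cyl r u) \<and>
       (\<Sum>(r, u)\<leftarrow>L. u) \<le> (1 - \<epsilon>) * w"
proof -
  define v where "v = word m z"
  obtain w0 L0 where v: "good v w0" "wval q v + w0 \<le> 1" "z \<in> cyl v w0"
    and L0: "\<forall>(p, w)\<in>set L0. good p w \<and> wval q p + w \<le> 1"
    "{0..<1} \<subseteq> cyl v w0 \<union> (\<Union>(p, w)\<in>set L0. cyl p w)" "(\<Sum>(p, w)\<leftarrow>L0. w) + w0 \<le> 1"
    using cylinder_partition[OF assms, of m] unfolding v_def by blast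
  have w0: "0 < w0" using v(3) by (auto simp: cyl_def)
  have "w0 \<le> 1" using v(2) wval_nonneg[of v] by linarith
  \<comment> \<open>The piece left out has length \<open>w0 / q ^ Suc n\<close>, which is at least
    \<open>(w0 / q) * w\<close> because \<open>q ^ n * w \<le> 1\<close>.\<close>
  define \<epsilon> where "\<epsilon> = w0 / q"
  have \<epsilon>: "0 < \<epsilon>" "\<epsilon> < 1" using w0 \<open>w0 \<le> 1\<close> q1 by (auto simp: \<epsilon>_def)
  have cover: "\<exists>L. length L \<le> N + length L0 \<and> (\<forall>(r, u)\<in>set L. good r u) \<and>
       {x \<in> cyl p w. \<not> occurs_in_greedy v x q} \<subseteq> (\<Union>(r, u)\<in>set L. cyl r u) \<and>
       (\<Sum>(r, u)\<leftarrow>L. u) \<le> (1 - \<epsilon>) * w" if gp: "good p w" for p w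
  proof (cases "w = 0")
    case True
    then show ?thesis by (intro exI[of _ "[]"]) (simp add: cyl_def)
  next
    case False
    then have "0 < w" using good_nonneg[OF gp] by simp
    then obtain p' where p': "good (p' @ 0 # v) (w0 / q ^ Suc (length p'))" "wval q p' = wval q p"
        "good p' w" "1 < q ^ Suc (length p') * w"
      using good_subcyl[OF v(1)[unfolded v_def] w0 v(2)[unfolded v_def] gp] unfolding v_def by blast
    define n where "n = length p'"
    define c where "c d = child_width n w d" for d
    have c0: "c 0 = 1 / q ^ Suc n"
      using p'(4) by (simp add: c_def child_width_def n_def field_simps)
    have g0: "good (p' @ [0]) (1 / q ^ Suc n)"
      using good_child[OF p'(3), of 0] c0 by (simp add: c_def n_def)
    define La where "La = map (\<lambda>d. (p' @ [d], c d)) [1..<Suc N]"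
    define Lb where "Lb = map (\<lambda>(r, u). (p' @ [0] @ r, u / q ^ Suc n)) L0"
    have sum_a: "(\<Sum>(r, u)\<leftarrow>La. u) = w - 1 / q ^ Suc n"
    proof -
      have "(\<Sum>(r, u)\<leftarrow>La. u) = (\<Sum>d\<in>{1..<Suc N}. c d)"
        by (simp only: La_def map_map comp_def prod.case interv_sum_list_conv_sum_set_nat set_upt)
      moreover have "(\<Sum>d<Suc N. c d) = c 0 + (\<Sum>d\<in>{1..<Suc N}. c d)"
        by (simp only: lessThan_atLeast0 sum.atLeast_Suc_lessThan[of 0 "Suc N"] zero_less_Suc One_nat_def)
      ultimately show ?thesis using sum_child_width[OF p'(3)] c0 by (simp add: c_def n_def)
    qed
    have "(\<Sum>(r, u)\<leftarrow>Lb. u) = (\<Sum>(r, u)\<leftarrow>L0. u) / q ^ Suc n"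
      unfolding Lb_def by (induction L0) (auto simp: add_divide_distrib)
    also have "\<dots> \<le> (1 - w0) / q ^ Suc n" using L0(3) by (intro divide_right_mono) auto
    finally have "(\<Sum>(r, u)\<leftarrow>La @ Lb. u) \<le> w - w0 / q ^ Suc n"
      using sum_a by (simp add: diff_divide_distrib)
    moreover have "\<epsilon> * w \<le> w0 / q ^ Suc n"
    proof -
      have "w0 * (q ^ n * w) \<le> w0 * 1" using p'(3) w0 by (intro mult_left_mono) (auto simp: good_def n_def)
      then show ?thesis by (simp add: \<epsilon>_def field_simps)
    qed
    ultimately have "(\<Sum>(r, u)\<leftarrow>La @ Lb. u) \<le> (1 - \<epsilon>) * w" by (simp add: algebra_simps)
    moreover have "length (La @ Lb) \<le> N + length L0" by (simp add: La_def Lb_def)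
    moreover have "\<forall>(r, u)\<in>set (La @ Lb). good r u"
    proof -
      have "good r u" if "(r, u) \<in> set La" for r u
        using that good_child[OF p'(3)] by (auto simp: La_def c_def n_def)
      moreover have "good r u" if rb: "(r, u) \<in> set Lb" for r u
      proof -
        obtain r' u' where r': "(r', u') \<in> set L0" "r = (p' @ [0]) @ r'" "u = u' / q ^ Suc n"
          using rb by (auto simp: Lb_def)
        then have "good r' u'" "wval q r' + u' \<le> 1" using L0(1) by auto
        then have "good ((p' @ [0]) @ r') (u' / q ^ length (p' @ [0]))"
          by (intro good_append[OF g0]) (auto simp: n_def)
        then show ?thesis using r' by (simp add: n_def)
      qed
      ultimately show ?thesis by auto
    qed
    moreover have "{x \<in> cyl p w. \<not> occurs_in_greedy v x q} \<subseteq> (\<Union>(r, u)\<in>set (La @ Lb). cyl r u)"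
    proof
      fix x assume "x \<in> {x \<in> cyl p w. \<not> occurs_in_greedy v x q}"
      then have x: "x \<in> cyl p' w" and nocc: "\<not> occurs_in_greedy v x q"
        using p'(2) by (auto simp: cyl_def)
      obtain d where d: "d \<le> N" "x \<in> cyl (p' @ [d]) (c d)"
        using cyl_children[OF p'(3) x] by (auto simp: c_def n_def)
      show "x \<in> (\<Union>(r, u)\<in>set (La @ Lb). cyl r u)"
      proof (cases "d = 0")
        case False
        then have "d \<in> set [1..<Suc N]" using d(1) by (simp del: upt_Suc)
        then have "(p' @ [d], c d) \<in> set La" unfolding La_def set_map by (rule imageI)
        then show ?thesis using d(2) by auto
      next
        case True
        \<comment> \<open>This is the position of \<open>x\<close> in the child with digit 0,
          rescaled to [0,1), where the partition \<open>L0\<close> applies.\<close>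
        define y where "y = q ^ Suc n * (x - wval q p')"
        have x_eq: "x = wval q p' + y / q ^ Suc n" by (simp add: y_def)
        have scale: "x \<in> cyl (p' @ [0] @ r) (u / q ^ Suc n) \<longleftrightarrow> y \<in> cyl r u" for r u
        proof -
          have "wval q (p' @ [0] @ r) = wval q p' + wval q r / q ^ Suc n"
            unfolding append_assoc[symmetric] wval_append[of q "p' @ [0]"] by (simp add: wval_snoc n_def)
          then have "x \<in> cyl (p' @ [0] @ r) (u / q ^ Suc n) \<longleftrightarrow>
              wval q r / q ^ Suc n \<le> y / q ^ Suc n \<and> y / q ^ Suc n < (wval q r + u) / q ^ Suc n"
            by (auto simp: cyl_def x_eq add_divide_distrib simp del: power_Suc)
          also have "\<dots> \<longleftrightarrow> y \<in> cyl r u"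
            by (simp add: cyl_def divide_le_cancel divide_less_cancel del: power_Suc)
          finally show ?thesis .
        qed
        have "y \<in> {0..<1}" using d(2) True c0 scale[of "[]" 1] by (simp add: cyl_def)
        moreover have "y \<notin> cyl v w0"
        proof
          assume "y \<in> cyl v w0"
          then have "x \<in> cyl ((p' @ [0]) @ v) (w0 / q ^ Suc n)" using scale by simp
          then have "occurs_in_greedy v x q" using p'(1)
            by (intro occurs_in_cyl[of "p' @ [0]" _ "w0 / q ^ Suc n"]) (auto simp: n_def)
          then show False using nocc by simp
        qed
        ultimately obtain r u where "(r, u) \<in> set L0" "y \<in> cyl r u" using L0(2) by blast
        then have "(p' @ [0] @ r, u / q ^ Suc n) \<in> set Lb" "x \<in> cyl (p' @ [0] @ r) (u / q ^ Suc n)"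
          using scale by (force simp: Lb_def)+
        then show ?thesis by auto
      qed
    qed
    ultimately show ?thesis by (intro exI[of _ "La @ Lb"]) blast
  qed
  show thesis by (rule that[OF \<epsilon>], rule cover[unfolded v_def])
qed

text \<open>The tangent bound for \<open>u / w\<close>, summed over at most \<open>M\<close> pieces,
  gives a sum of \<open>s\<close>-th powers of at most
  \<open>w powr s * ((1 - \<epsilon>) + M * (1 - s))\<close>. For \<open>s\<close> near 1 the factor
  is below 1 and the same at every step, so \<open>k\<close> refinements gain its
  \<open>k\<close>-th power.\<close>

lemma avoiding_hnull_cyl:
  assumes "0 \<le> z" "z < 1"
  obtains s where "0 < s" "s < 1"
    "\<And>p w. good p w \<Longrightarrow> hnull s {x \<in> cyl p w. \<not> occurs_in_greedy (word m z) x q}"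
proof -
  obtain M \<epsilon> where \<epsilon>: "0 < \<epsilon>" "\<epsilon> < 1" and step:
    "\<And>p w. good p w \<Longrightarrow> \<exists>L. length L \<le> M \<and> (\<forall>(r, u)\<in>set L. good r u) \<and>
       {x \<in> cyl p w. \<not> occurs_in_greedy (word m z) x q} \<subseteq> (\<Union>(r, u)\<in>set L. cyl r u) \<and>
       (\<Sum>(r, u)\<leftarrow>L. u) \<le> (1 - \<epsilon>) * w"
    by (rule avoiding_cover_step[OF assms, of m]) (rule that)
  \<comment> \<open>This makes \<open>M * (1 - s) \<le> \<epsilon> / 2\<close>, so half of the gain
    in length survives as \<open>\<rho> = 1 - \<epsilon> / 2\<close>; the \<open>+ 1\<close> covers
    \<open>M = 0\<close>.\<close>
  define s where "s = 1 - \<epsilon> / (2 * (real M + 1))"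
  have "\<epsilon> / (2 * (real M + 1)) < 1" using \<epsilon> by (simp add: divide_less_eq)
  then have s: "0 < s" "s < 1" using \<epsilon> by (auto simp: s_def)
  have Ms: "real M * (1 - s) \<le> \<epsilon> / 2" using \<epsilon> by (simp add: s_def field_simps)
  define \<rho> where "\<rho> = 1 - \<epsilon> / 2"
  have \<rho>: "0 < \<rho>" "\<rho> < 1" using \<epsilon> by (auto simp: \<rho>_def)
  let ?S = "\<lambda>L :: (nat list \<times> real) list. (\<Sum>(r, u)\<leftarrow>L. u powr s)"
  let ?A = "\<lambda>p w. {x \<in> cyl p w. \<not> occurs_in_greedy (word m z) x q}"
  have step': "\<exists>L. (\<forall>(r, u)\<in>set L. good r u) \<and> ?A p w \<subseteq> (\<Union>(r, u)\<in>set L. cyl r u) \<and>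
       ?S L \<le> \<rho> * w powr s" if g: "good p w" for p w
  proof (cases "w = 0")
    case True
    then show ?thesis by (intro exI[of _ "[]"]) (simp add: cyl_def)
  next
    case False
    then have w: "0 < w" using good_nonneg[OF g] by simp
    obtain L where L: "length L \<le> M" "\<forall>(r, u)\<in>set L. good r u" "?A p w \<subseteq> (\<Union>(r, u)\<in>set L. cyl r u)"
      "(\<Sum>(r, u)\<leftarrow>L. u) \<le> (1 - \<epsilon>) * w"
      using step[OF g] by blast
    have "?S L \<le> (\<Sum>(r, u)\<leftarrow>L. w powr s * (s * (u / w) + (1 - s)))"
    proof (intro sum_list_mono, clarify)
      fix r u assume "(r, u) \<in> set L"
      then have "0 \<le> u" using L(2) good_nonneg by blast
      then have "(u / w) powr s \<le> s * (u / w) + (1 - s)" using w s by (intro powr_le_tangent) auto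
      then have "w powr s * (u / w) powr s \<le> w powr s * (s * (u / w) + (1 - s))"
        by (intro mult_left_mono) auto
      then show "u powr s \<le> w powr s * (s * (u / w) + (1 - s))"
        using w \<open>0 \<le> u\<close> by (simp flip: powr_mult)
    qed
    also have "\<dots> = w powr s * (s * ((\<Sum>(r, u)\<leftarrow>L. u) / w) + real (length L) * (1 - s))"
      by (induction L) (auto simp: algebra_simps add_divide_distrib)
    also have "\<dots> \<le> w powr s * \<rho>"
    proof (intro mult_left_mono)
      have sum0: "0 \<le> (\<Sum>(r, u)\<leftarrow>L. u) / w"
        using L(2) good_nonneg w by (intro divide_nonneg_pos sum_list_nonneg) auto
      have "s * ((\<Sum>(r, u)\<leftarrow>L. u) / w) \<le> 1 * ((\<Sum>(r, u)\<leftarrow>L. u) / w)"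
        using s sum0 by (intro mult_right_mono) auto
      also have "\<dots> \<le> 1 - \<epsilon>" using L(4) w by (simp add: divide_le_eq)
      finally have "s * ((\<Sum>(r, u)\<leftarrow>L. u) / w) \<le> 1 - \<epsilon>" .
      moreover have "real (length L) * (1 - s) \<le> real M * (1 - s)"
        using L(1) s by (intro mult_right_mono) auto
      ultimately show "s * ((\<Sum>(r, u)\<leftarrow>L. u) / w) + real (length L) * (1 - s) \<le> \<rho>"
        using Ms by (simp add: \<rho>_def)
    qed simp
    finally show ?thesis using L by (intro exI[of _ L]) (simp add: mult.commute)
  qed
  have flatten: "\<exists>L'. (\<forall>(r, u)\<in>set L'. good r u) \<and>
      {x \<in> (\<Union>(r, u)\<in>set L. cyl r u). \<not> occurs_in_greedy (word m z) x q} \<subseteq> (\<Union>(r, u)\<in>set L'. cyl r u) \<and>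
      ?S L' \<le> \<rho> * ?S L" if "\<forall>(r, u)\<in>set L. good r u" for L
    using that
  proof (induction L)
    case Nil
    then show ?case by (intro exI[of _ "[]"]) simp
  next
    case (Cons a L)
    obtain p w where a: "a = (p, w)" by fastforce
    obtain L1 where L1: "\<forall>(r, u)\<in>set L1. good r u" "?A p w \<subseteq> (\<Union>(r, u)\<in>set L1. cyl r u)"
       "?S L1 \<le> \<rho> * w powr s" using step'[of p w] Cons.prems a by auto
    obtain L2 where L2: "\<forall>(r, u)\<in>set L2. good r u"
      "{x \<in> (\<Union>(r, u)\<in>set L. cyl r u). \<not> occurs_in_greedy (word m z) x q} \<subseteq> (\<Union>(r, u)\<in>set L2. cyl r u)"
      "?S L2 \<le> \<rho> * ?S L" using Cons.IH Cons.prems by auto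
    show ?case
    proof (intro exI[of _ "L1 @ L2"] conjI)
      show "\<forall>(r, u)\<in>set (L1 @ L2). good r u" using L1(1) L2(1) by auto
      show "?S (L1 @ L2) \<le> \<rho> * ?S (a # L)" using L1(3) L2(3) a by (simp add: distrib_left)
      show "{x \<in> (\<Union>(r, u)\<in>set (a # L). cyl r u). \<not> occurs_in_greedy (word m z) x q}
        \<subseteq> (\<Union>(r, u)\<in>set (L1 @ L2). cyl r u)"
        using L1(2) L2(2) unfolding a by fastforce
    qed
  qed
  have iter: "\<exists>L. (\<forall>(r, u)\<in>set L. good r u) \<and> ?A p w \<subseteq> (\<Union>(r, u)\<in>set L. cyl r u) \<and>
       ?S L \<le> \<rho> ^ k * w powr s" if g: "good p w" for p w k
  proof (induction k)
    case 0
    show ?case using g by (intro exI[of _ "[(p, w)]"]) auto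
  next
    case (Suc k)
    then obtain L where L: "\<forall>(r, u)\<in>set L. good r u" "?A p w \<subseteq> (\<Union>(r, u)\<in>set L. cyl r u)"
       "?S L \<le> \<rho> ^ k * w powr s" by blast
    obtain L' where L': "\<forall>(r, u)\<in>set L'. good r u"
      "{x \<in> (\<Union>(r, u)\<in>set L. cyl r u). \<not> occurs_in_greedy (word m z) x q} \<subseteq> (\<Union>(r, u)\<in>set L'. cyl r u)"
      "?S L' \<le> \<rho> * ?S L" using flatten[OF L(1)] by blast
    have "\<rho> * ?S L \<le> \<rho> * (\<rho> ^ k * w powr s)" using L(3) \<rho> by (intro mult_left_mono) auto
    then have "?S L' \<le> \<rho> ^ Suc k * w powr s" using L'(3) by (simp add: mult.assoc)
    moreover have "?A p w \<subseteq> (\<Union>(r, u)\<in>set L'. cyl r u)" using L(2) L'(2) by blast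
    ultimately show ?case using L'(1) by blast
  qed
  have null: "hnull s (?A p w)" if g: "good p w" for p w
  proof (rule hnull_finite_cover)
    fix e :: real assume "0 < e"
    have "(\<lambda>k. \<rho> ^ k * w powr s) \<longlonglongrightarrow> 0 * w powr s"
      using \<rho> by (intro tendsto_mult_right LIMSEQ_power_zero) auto
    then have "\<forall>\<^sub>F k in sequentially. \<rho> ^ k * w powr s < e"
      using \<open>0 < e\<close> by (intro order_tendstoD) auto
    then obtain k where k: "\<rho> ^ k * w powr s < e" by (auto simp: eventually_sequentially)
    obtain L where L: "\<forall>(r, u)\<in>set L. good r u" "?A p w \<subseteq> (\<Union>(r, u)\<in>set L. cyl r u)"
       "?S L \<le> \<rho> ^ k * w powr s" using iter[OF g] by blast
    define Us where "Us = map (\<lambda>(r, u). cyl r u) L"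
    have "(\<Sum>U\<leftarrow>Us. diameter U powr s) \<le> ?S L"
      unfolding Us_def map_map
    proof (intro sum_list_mono, clarsimp)
      fix r u assume "(r, u) \<in> set L"
      then have "0 \<le> u" using L(1) good_nonneg by blast
      then have "diameter (cyl r u) \<le> u" by (intro diameter_le) (auto simp: cyl_def)
      moreover have "0 \<le> diameter (cyl r u)" by (intro diameter_ge_0) (simp add: cyl_def)
      ultimately show "diameter (cyl r u) powr s \<le> u powr s" using s by (intro powr_mono2) auto
    qed
    then have "(\<Sum>U\<leftarrow>Us. diameter U powr s) \<le> e" using L(3) k by linarith
    moreover have "?A p w \<subseteq> \<Union>(set Us)" using L(2) by (auto simp: Us_def)
    moreover have "\<forall>U\<in>set Us. bounded U" by (auto simp: Us_def cyl_def)
    ultimately show "\<exists>Us. ?A p w \<subseteq> \<Union>(set Us) \<and> (\<forall>U\<in>set Us. bounded U) \<and> (\<Sum>U\<leftarrow>Us. diameter U powr s) \<le> e"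
      by blast
  qed
  show thesis by (rule that[OF s], rule null)
qed

section \<open>From good intervals to all of \<open>J q\<close>\<close>

definition top_pt :: real where "top_pt = real N / (q - 1)"

lemma J_eq: "J q = {0..top_pt}"
  by (simp add: J_def nq_eq top_pt_def)

lemma wval_replicate_N: "wval q (replicate n N) = top_pt * (1 - 1 / q ^ n)"
proof (induction n)
  case (Suc n)
  have "real N = top_pt * (q - 1)" using q1 by (simp add: top_pt_def)
  moreover have "replicate (Suc n) N = replicate n N @ [N]" by (simp add: replicate_append_same)
  ultimately show ?case unfolding wval_snoc by (simp only: wval_snoc Suc) (simp add: field_simps)
qed simp

text \<open>These intervals may reach beyond 1, so \<open>good_append\<close> does not produce them.
  The cap in \<open>dig\<close> does: \<open>N \<le> q * x\<close> alone forces the digit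
  \<open>N\<close>, and the induction strips this leading digit.\<close>

lemma good_replicate_N: "good (replicate n N) (1 / q ^ n)"
proof (induction n)
  case 0
  show ?case by (simp add: good_Nil)
next
  case (Suc n)
  have wval: "wval q (N # replicate n N) = real N / q + wval q (replicate n N) / q"
    using wval_append[of q "[N]" "replicate n N"] by simp
  have "word (1 + n) x = N # replicate n N" if x: "x \<in> cyl (N # replicate n N) (1 / q ^ Suc n)" for x
  proof -
    have "q * wval q (N # replicate n N) \<le> q * x" "q * x < q * (wval q (N # replicate n N) + 1 / q ^ Suc n)"
      using x by (auto simp: cyl_def)
    then have qx: "real N + wval q (replicate n N) \<le> q * x"
        "q * x < real N + wval q (replicate n N) + 1 / q ^ n"
      by (simp_all add: wval distrib_left)
    then have "int N \<le> \<lfloor>q * x\<rfloor>" using wval_nonneg[of "replicate n N"] by (simp add: le_floor_iff)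
    then have dig: "dig x = N" by (simp add: dig_def)
    then have "T x \<in> cyl (replicate n N) (1 / q ^ n)" using qx by (simp add: T_def cyl_def)
    then have "word n (T x) = replicate n N" using Suc by (simp add: good_def)
    then show ?thesis unfolding word_add by (simp add: word_def dig)
  qed
  then show ?case by (simp add: good_def)
qed

text \<open>The left ends increase to \<open>top_pt\<close>, and consecutive ones differ by
  \<open>N / q ^ Suc n\<close>, less than the width \<open>1 / q ^ n\<close> because
  \<open>N < q\<close>. Hence the intervals leave no gap; only the limit \<open>top_pt\<close> is
  missed.\<close>

lemma J_cover:
  assumes "0 \<le> x" "x < top_pt"
  shows "\<exists>n. x \<in> cyl (replicate n N) (1 / q ^ n)"
proof -
  obtain k where k: "top_pt / (top_pt - x) < q ^ k" using real_arch_pow[OF q1] by blast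
  then have "x < top_pt * (1 - 1 / q ^ k)" using assms by (simp add: field_simps)
  also have "\<dots> \<le> top_pt * (1 - 1 / q ^ Suc k)"
    using assms q1 by (intro mult_left_mono) (auto simp: field_simps)
  finally have ex: "\<exists>k. x < wval q (replicate (Suc k) N)" unfolding wval_replicate_N by blast
  define n where "n = (LEAST k. x < wval q (replicate (Suc k) N))"
  have n: "x < wval q (replicate (Suc n) N)" unfolding n_def using ex by (rule LeastI_ex)
  have "wval q (replicate n N) \<le> x"
  proof (cases n)
    case (Suc k)
    then have "k < (LEAST k. x < wval q (replicate (Suc k) N))" by (simp add: n_def)
    from not_less_Least[OF this] show ?thesis using Suc by simp
  qed (use assms in simp)
  moreover have "wval q (replicate (Suc n) N) \<le> wval q (replicate n N) + 1 / q ^ n"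
  proof -
    have "replicate (Suc n) N = replicate n N @ [N]" by (simp add: replicate_append_same)
    then show ?thesis using N_less by (simp only: wval_snoc) (simp add: field_simps)
  qed
  ultimately show ?thesis using n by (auto simp: cyl_def)
qed

lemma top_pt_ge_1: "1 \<le> top_pt"
  using N_ge q1 by (simp add: top_pt_def)

abbreviation avoiding :: "nat list \<Rightarrow> real set" where
  "avoiding v \<equiv> {x \<in> J q. \<not> occurs_in_greedy v x q}"

lemma avoiding_hnull:
  assumes "0 \<le> y" "y < 1"
  obtains s where "0 < s" "s < 1" "hnull s (avoiding (greedy_word y q l m))"
proof -
  define z where "z = (T ^^ l) y"
  have z: "0 \<le> z" "z < 1" using Tn_nonneg Tn_less_1 assms by (auto simp: z_def)
  have gw: "greedy_word y q l m = word m z" using greedy_word_eq assms by (simp add: z_def)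
  obtain s where s: "0 < s" "s < 1"
    "\<And>p w. good p w \<Longrightarrow> hnull s {x \<in> cyl p w. \<not> occurs_in_greedy (word m z) x q}"
    by (rule avoiding_hnull_cyl[OF z, of m]) (rule that)
  let ?E = "\<lambda>n. {x \<in> cyl (replicate n N) (1 / q ^ n). \<not> occurs_in_greedy (word m z) x q}"
  have "hnull s (insert top_pt (\<Union>n. ?E n))"
    by (intro hnull_insert hnull_UN s(3) good_replicate_N)
  moreover have "avoiding (word m z) \<subseteq> insert top_pt (\<Union>n. ?E n)"
    using J_cover by (force simp: J_eq)
  ultimately have "hnull s (avoiding (word m z))" by (rule hnull_subset)
  then show thesis using that[OF s(1,2)] gw by simp
qed

section \<open>Nowhere density\<close>

lemma good_refine:
  assumes "good p w" "x \<in> cyl p w"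
  shows "\<exists>p' w'. good p' w' \<and> x \<in> cyl p' w' \<and> length p' = length p + k"
proof (induction k)
  case (Suc k)
  then show ?case using cyl_children good_child
    by (metis add_Suc_right length_append_singleton)
qed (use assms in auto)

text \<open>Every ball around a point of \<open>J q\<close> other than \<open>top_pt\<close>
  contains a good interval, and every good interval of positive width contains an open interval on
  which the word occurs.\<close>

lemma avoiding_nowhere_dense:
  assumes "0 \<le> y" "y < 1"
  shows "nowhere_dense (avoiding (greedy_word y q l m))"
proof -
  define z where "z = (T ^^ l) y"
  have z: "0 \<le> z" "z < 1" using Tn_nonneg Tn_less_1 assms by (auto simp: z_def)
  have gw: "greedy_word y q l m = word m z" using greedy_word_eq assms by (simp add: z_def)
  obtain v where v: "good (word m z) v" "wval q (word m z) + v \<le> 1" "z \<in> cyl (word m z) v"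
    using cylinder_partition[OF z, of m] by blast
  have v0: "0 < v" using v(3) by (auto simp: cyl_def)
  define S where "S = avoiding (word m z)"
  have False if x: "x \<in> interior (closure S)" for x
  proof -
    \<comment> \<open>An interior point lies strictly below \<open>top_pt\<close>, where the
      intervals of \<open>J_cover\<close> are available.\<close>
    have "closure S \<subseteq> {0..top_pt}"
      by (rule closure_minimal) (auto simp: S_def J_eq)
    then have "interior (closure S) \<subseteq> {0<..<top_pt}"
      using interior_mono by (metis interior_atLeastAtMost_real)
    then have "0 \<le> x" "x < top_pt" using x by auto
    then obtain n where n: "x \<in> cyl (replicate n N) (1 / q ^ n)" using J_cover by blast
    obtain e where e: "0 < e" "ball x e \<subseteq> interior (closure S)"
      using x open_contains_ball[of "interior (closure S)"] by auto
    \<comment> \<open>At this depth every good interval is shorter than \<open>e\<close>, so one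
      through \<open>x\<close> stays in the ball.\<close>
    obtain k where k: "1 / e < q ^ k" using real_arch_pow[OF q1] by blast
    obtain p w where p: "good p w" "x \<in> cyl p w" "length p = length (replicate n N) + k"
      using good_refine[OF good_replicate_N n] by blast
    have "1 / e < q ^ length p"
      using k p(3) q1 by (auto intro!: order_less_le_trans[OF k] power_increasing)
    then have "1 < q ^ length p * e" using e by (simp add: field_simps)
    moreover have "q ^ length p * w \<le> 1" using p(1) by (simp add: good_def)
    ultimately have "q ^ length p * w < q ^ length p * e" by linarith
    then have "w < e" by simp
    then have sub: "cyl p w \<subseteq> ball x e" using p(2) by (auto simp: cyl_def dist_real_def)
    have "0 < w" using p(2) by (auto simp: cyl_def)
    obtain p' where p': "good (p' @ 0 # word m z) (v / q ^ Suc (length p'))"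
        "cyl (p' @ 0 # word m z) (v / q ^ Suc (length p')) \<subseteq> cyl p w"
      using good_subcyl[OF v(1) v0 v(2) p(1) \<open>0 < w\<close>] by blast
    define a where "a = wval q (p' @ 0 # word m z)"
    define u where "u = v / q ^ Suc (length p')"
    have "0 < u" using v0 by (simp add: u_def)
    have "{a<..<a + u} \<inter> S = {}"
    proof -
      have "occurs_in_greedy (word m z) t q" if "t \<in> {a<..<a + u}" for t
      proof -
        have "t \<in> cyl ((p' @ [0]) @ word m z) u" using that by (simp add: cyl_def a_def)
        then show ?thesis using p'(1) 
            by (intro occurs_in_cyl[of "p' @ [0]" _ u]) (auto simp: u_def)
      qed
      then show ?thesis by (auto simp: S_def)
    qed
    then have "{a<..<a + u} \<inter> closure S = {}" by (simp add: open_Int_closure_eq_empty)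
    moreover have "a + u / 2 \<in> {a<..<a + u}" using \<open>0 < u\<close> by simp
    moreover have "a + u / 2 \<in> cyl (p' @ 0 # word m z) (v / q ^ Suc (length p'))"
      using \<open>0 < u\<close> unfolding cyl_def a_def[symmetric] u_def[symmetric] by simp
    then have "a + u / 2 \<in> closure S" using p'(2) sub e(2) interior_subset by blast
    ultimately show False by blast
  qed
  then show ?thesis unfolding nowhere_dense_def gw S_def by blast
qed

subsection \<open>Counting full words\<close>

text \<open>Width \<open>1 / q ^ n\<close> means that \<open>n\<close> steps map the interval onto
  all of [0,1). The last condition keeps the interval itself inside [0,1), so that it can be placed
  behind other full words.\<close>

definition full :: "nat \<Rightarrow> nat list set" where
  "full n = {p. length p = n \<and> good p (1 / q ^ n) \<and> wval q p + 1 / q ^ n \<le> 1}"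

lemma full_word: "p \<in> full n \<Longrightarrow> x \<in> cyl p (1 / q ^ n) \<Longrightarrow> word n x = p"
  by (auto simp: full_def good_def)

text \<open>The letters are bounded because \<open>p\<close> is the digit word of the left end of
  its interval.\<close>

lemma finite_full: "finite (full n)"
proof (rule finite_subset)
  show "full n \<subseteq> {p. set p \<subseteq> {..N} \<and> length p = n}"
  proof
    fix p assume p: "p \<in> full n"
    then have "word n (wval q p) = p" by (rule full_word) (simp add: cyl_def)
    moreover have "set (word n (wval q p)) \<subseteq> {..N}" by (auto simp: word_def dig_def)
    ultimately show "p \<in> {p. set p \<subseteq> {..N} \<and> length p = n}" using p by (simp add: full_def)
  qed
qed (simp add: finite_lists_length_eq)

text \<open>Otherwise the left end for \<open>r\<close> would lie in both intervals and have two
  different digit prefixes of length \<open>n\<close>.\<close>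

lemma full_separated:
  assumes "p \<in> full n" "r \<in> full n" "wval q p \<le> wval q r" "p \<noteq> r"
  shows "wval q p + 1 / q ^ n \<le> wval q r"
proof (rule ccontr)
  assume "\<not> ?thesis"
  then have "wval q r \<in> cyl p (1 / q ^ n)" using assms(3) by (simp add: cyl_def)
  moreover have "wval q r \<in> cyl r (1 / q ^ n)" by (simp add: cyl_def)
  ultimately show False using full_word assms by metis
qed

text \<open>Putting a 0 in front is injective and keeps words full, because the digit 0 has the full
  interval [0,1/q).\<close>

lemma card_full_Suc: "card (full n) \<le> card (full (Suc n))"
proof (rule card_inj_on_le)
  show "(#) 0 ` full n \<subseteq> full (Suc n)"
  proof
    fix r assume "r \<in> (#) 0 ` full n"
    then obtain p where p: "p \<in> full n" "r = [0] @ p" by auto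
    have "good [0] (1 / q)" by (intro good_single) auto
    then have "good r (1 / q ^ n / q ^ length [0::nat])"
      unfolding p(2) using p(1) by (intro good_append) (auto simp: full_def)
    moreover have "wval q r + 1 / q ^ Suc n = (wval q p + 1 / q ^ n) / q"
      unfolding p(2) wval_append by (simp add: add_divide_distrib)
    moreover have "(wval q p + 1 / q ^ n) / q \<le> 1 / 1"
      using p(1) q1 by (intro frac_le) (auto simp: full_def)
    ultimately show "r \<in> full (Suc n)" using p by (simp add: full_def mult.commute)
  qed
qed (auto simp: finite_full)

text \<open>A counts the non-full intervals: each interval of level n has at most one such child.\<close>
lemma full_cover:
  "\<exists>A. finite A \<and> card A \<le> (\<Sum>k<n. card (full k)) \<and>
     (\<forall>(p, w)\<in>A. length p = n \<and> good p w \<and> wval q p + w \<le> 1) \<and>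
     {0..<1} \<subseteq> (\<Union>p\<in>full n. cyl p (1 / q ^ n)) \<union> (\<Union>(p, w)\<in>A. cyl p w)"
proof (induction n)
  case 0
  have "[] \<in> full 0" by (simp add: full_def good_Nil)
  then show ?case by (intro exI[of _ "{}"]) (auto simp: cyl_def)
next
  case (Suc n)
  obtain A where A: "finite A" "card A \<le> (\<Sum>k<n. card (full k))"
     "\<forall>(p, w)\<in>A. length p = n \<and> good p w \<and> wval q p + w \<le> 1"
     "{0..<1} \<subseteq> (\<Union>p\<in>full n. cyl p (1 / q ^ n)) \<union> (\<Union>(p, w)\<in>A. cyl p w)"
    using Suc by blast
  define \<delta> where "\<delta> = 1 / q ^ Suc n"
  have \<delta>: "0 < \<delta>" by (simp add: \<delta>_def)
  have cw: "child_width n w d = max 0 (min \<delta> (w - real d * \<delta>))" for w d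
    by (simp add: child_width_def \<delta>_def)
  define B where "B = (\<lambda>p. (p, 1 / q ^ n)) ` full n \<union> A"
  have B: "finite B" using A(1) finite_full by (simp add: B_def)
  have cardB: "card B \<le> (\<Sum>k<Suc n. card (full k))"
  proof -
    have "card B \<le> card ((\<lambda>p. (p, 1 / q ^ n)) ` full n) + card A"
      unfolding B_def by (rule card_Un_le)
    also have "\<dots> \<le> card (full n) + (\<Sum>k<n. card (full k))"
      by (intro add_mono card_image_le finite_full A)
    finally show ?thesis by simp
  qed
  have Bg: "length p = n \<and> good p w \<and> wval q p + w \<le> 1" if "(p, w) \<in> B" for p w
    using that A(3) by (auto simp: B_def full_def)
  \<comment> \<open>Children before this digit are full, the one at it is cut short or empty, and
    all later ones are empty.\<close>
  define last_d where "last_d w = nat \<lfloor>w / \<delta>\<rfloor>" for w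
  have last: "real (last_d w) * \<delta> \<le> w \<and> w < (real (last_d w) + 1) * \<delta>" if "(p, w) \<in> B" for p w
  proof -
    have "0 \<le> w" using Bg[OF that] good_nonneg by blast
    then have "0 \<le> w / \<delta>" using \<delta> by simp
    then have "real (last_d w) \<le> w / \<delta>" "w / \<delta> < real (last_d w) + 1" by (simp_all add: last_d_def)
    then show ?thesis using \<delta> by (simp add: pos_le_divide_eq pos_divide_less_eq)
  qed
  define lc where "lc = (\<lambda>(p, w). (p @ [last_d w], child_width n w (last_d w)))"
  have wv: "wval q (p @ [d]) = wval q p + real d * \<delta>" if "length p = n" for p d
    using that by (simp add: wval_snoc \<delta>_def)
  show ?case
  proof (intro exI[of _ "lc ` B"] conjI)
    show "finite (lc ` B)" using B by simp
    show "card (lc ` B) \<le> (\<Sum>k<Suc n. card (full k))" using card_image_le[OF B] cardB by (rule order_trans)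
    show "\<forall>(p, w)\<in>lc ` B. length p = Suc n \<and> good p w \<and> wval q p + w \<le> 1"
    proof clarify
      fix r u p w assume *: "(r, u) = lc (p, w)" "(p, w) \<in> B"
      then have r: "r = p @ [last_d w]" "u = child_width n w (last_d w)" by (auto simp: lc_def)
      note g = Bg[OF *(2)] and l = last[OF *(2)]
      have "good r u"
      proof (cases "last_d w \<le> N")
        case True
        then show ?thesis using good_child[of p w "last_d w"] g r by simp
      next
        \<comment> \<open>This happens only if \<open>q = N + 1\<close> and the parent is full; the
          child at \<open>last_d w\<close> is then empty.\<close>
        case False
        have "w * q ^ Suc n \<le> q" using good_mult_less[of p w] g by simp
        also have "q \<le> real (last_d w)" using False N_ge by simp
        finally have "w \<le> real (last_d w) * \<delta>" by (simp add: \<delta>_def pos_le_divide_eq del: power_Suc)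
        then show ?thesis using r cw \<delta> by simp
      qed
      moreover have "wval q r + u \<le> 1" using g l \<delta> by (simp add: r wv cw) linarith
      ultimately show "length r = Suc n \<and> good r u \<and> wval q r + u \<le> 1" using r g by simp
    qed
    show "{0..<1} \<subseteq> (\<Union>p\<in>full (Suc n). cyl p (1 / q ^ Suc n)) \<union> (\<Union>(p, w)\<in>lc ` B. cyl p w)"
    proof
      fix x :: real assume "x \<in> {0..<1}"
      then obtain p w where pw: "(p, w) \<in> B" "x \<in> cyl p w"
        using A(4) unfolding B_def by blast
      note g = Bg[OF pw(1)] and l = last[OF pw(1)]
      obtain d where d: "d \<le> N" "x \<in> cyl (p @ [d]) (child_width n w d)"
        using cyl_children[of p w x] g pw(2) by blast
      consider "d < last_d w" | "d = last_d w" | "last_d w < d" by linarith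
      then show "x \<in> (\<Union>p\<in>full (Suc n). cyl p (1 / q ^ Suc n)) \<union> (\<Union>(p, w)\<in>lc ` B. cyl p w)"
      proof cases
        case 1
        then have "(real d + 1) * \<delta> \<le> real (last_d w) * \<delta>" using \<delta> by (intro mult_right_mono) auto
        then have le: "real d * \<delta> + \<delta> \<le> w" using l by (simp add: distrib_right)
        then have "child_width n w d = \<delta>" using \<delta> by (simp add: cw)
        moreover have "good (p @ [d]) (child_width n w d)" using good_child[of p w d] g d by blast
        ultimately have "p @ [d] \<in> full (Suc n)" "x \<in> cyl (p @ [d]) (1 / q ^ Suc n)"
          using g le d(2) by (auto simp: full_def wv \<delta>_def[symmetric] simp del: power_Suc)
        then show ?thesis by blast
      next
        case 2
        then have "lc (p, w) = (p @ [d], child_width n w d)" by (simp add: lc_def)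
        then have "(p @ [d], child_width n w d) \<in> lc ` B" using imageI[OF pw(1), of lc] by simp
        then show ?thesis using d(2) by blast
      next
        case 3
        then have "(real (last_d w) + 1) * \<delta> \<le> real d * \<delta>" using \<delta> by (intro mult_right_mono) auto
        then have "w - real d * \<delta> \<le> 0" using l by linarith
        then have "child_width n w d = 0" by (simp add: cw)
        then show ?thesis using d(2) by (simp add: cyl_def)
      qed
    qed
  qed
qed

text \<open>The intervals of level \<open>n\<close> have length at most \<open>1 / q ^ n\<close> and
  cover [0,1), so there are at least \<open>q ^ n\<close> of them. By \<open>full_cover\<close> and
  the monotonicity of \<open>card (full k)\<close> there are at most
  \<open>Suc n * card (full n)\<close>.\<close>

lemma card_full_ge: "q ^ n \<le> real (Suc n) * real (card (full n))"
proof -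
  obtain A where A: "finite A" "card A \<le> (\<Sum>k<n. card (full k))"
     "\<forall>(p, w)\<in>A. length p = n \<and> good p w \<and> wval q p + w \<le> 1"
     "{0..<1} \<subseteq> (\<Union>p\<in>full n. cyl p (1 / q ^ n)) \<union> (\<Union>(p, w)\<in>A. cyl p w)"
    using full_cover[of n] by (elim exE conjE) (rule that)
  define B where "B = (\<lambda>p. (p, 1 / q ^ n)) ` full n \<union> A"
  have B: "finite B" using A(1) finite_full by (simp add: B_def)
  have width: "0 \<le> w \<and> w \<le> 1 / q ^ n" if "(p, w) \<in> B" for p w
  proof -
    have "length p = n" "good p w" using that A(3) by (auto simp: B_def full_def)
    then show ?thesis by (simp add: good_def field_simps)
  qed
  have "{0..<1} \<subseteq> (\<Union>(p, w)\<in>B. cyl p w)"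
    by (rule order_trans[OF A(4)]) (auto simp: B_def)
  then have "measure lborel {0..<1::real} \<le> measure lborel (\<Union>(p, w)\<in>B. cyl p w)"
  proof (intro measure_mono_fmeasurable fmeasurable.finite_UN B)
    fix pw assume "pw \<in> B"
    then show "(case pw of (p, w) \<Rightarrow> cyl p w) \<in> fmeasurable lborel"
      using width by (cases pw) (auto simp: cyl_def intro!: fmeasurableI)
  qed simp_all
  also have "\<dots> \<le> (\<Sum>pw\<in>B. measure lborel (case pw of (p, w) \<Rightarrow> cyl p w))"
    by (rule measure_UNION_le[OF B]) (auto simp: cyl_def)
  also have "\<dots> \<le> (\<Sum>pw\<in>B. 1 / q ^ n)"
    by (intro sum_mono) (use width in \<open>auto simp: cyl_def\<close>)
  finally have "q ^ n \<le> real (card B)" by (simp add: field_simps)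
  also have "card B \<le> card ((\<lambda>p. (p, 1 / q ^ n)) ` full n) + card A"
    unfolding B_def by (rule card_Un_le)
  also have "\<dots> \<le> card (full n) + (\<Sum>k<n. card (full k))"
    by (intro add_mono card_image_le finite_full A)
  also have "(\<Sum>k<n. card (full k)) \<le> (\<Sum>k<n. card (full n))"
    using lift_Suc_mono_le[of "\<lambda>n. card (full n)"] card_full_Suc by (intro sum_mono) auto
  finally show ?thesis by (simp add: algebra_simps)
qed

subsection \<open>Avoiding long blocks of zeros\<close>

text \<open>The count \<open>q ^ L / (L + 1)\<close> of full words beats
  \<open>(q powr s) ^ L\<close> exponentially, which leaves room to discard half of the
  words.\<close>

lemma separated_full_words:
  assumes "0 < s" "s < 1"
  obtains L B a where "1 < B" "0 < L" "(q powr s) ^ L \<le> real B"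
    "\<And>j. j < B \<Longrightarrow> a j \<in> full L \<and> 0 < wval q (a j) \<and> wval q (a j) + 2 * (1 / q ^ L) \<le> 1"
    "\<And>i j. i < j \<Longrightarrow> j < B \<Longrightarrow> wval q (a i) + 2 * (1 / q ^ L) \<le> wval q (a j)"
proof -
  define p where "p = q powr s"
  have p: "1 < p" "p < q"
    using assms q1 powr_less_mono[of 0 s q] powr_less_mono[of s 1 q] by (auto simp: p_def)
  define r where "r = p / q"
  have r: "0 < r" "r < 1" using p by (auto simp: r_def)
  \<comment> \<open>Smallness of this expression yields
    \<open>2 * p ^ L + 2 \<le> card (full L)\<close>, just enough for \<open>p ^ L\<close> words
    after halving; the 4 comes from \<open>2 * p ^ L + 2 \<le> 4 * p ^ L\<close>.\<close>
  have "(\<lambda>n. 4 * (real n * r ^ n) + 4 * r ^ n) \<longlonglongrightarrow> 4 * 0 + 4 * 0"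
    using r by (intro tendsto_intros powser_times_n_limit_0) auto
  then have "\<forall>\<^sub>F n in sequentially. 4 * (real n * r ^ n) + 4 * r ^ n < 1"
    by (rule order_tendstoD) simp
  then obtain L where L: "0 < L" "4 * (real L * r ^ L) + 4 * r ^ L < 1"
    unfolding eventually_sequentially by (metis le_add1 le_add2 less_numeral_extra(1) order_less_le_trans)
  define \<delta> where "\<delta> = 1 / q ^ L"
  have \<delta>: "0 < \<delta>" by (simp add: \<delta>_def)
  define K where "K = card (full L)"
  have "1 \<le> p ^ L" using p by simp
  have "real (Suc L) * (2 * p ^ L + 2) \<le> real (Suc L) * (4 * p ^ L)"
    using \<open>1 \<le> p ^ L\<close> by (intro mult_left_mono) auto
  also have "\<dots> = q ^ L * (4 * (real L * r ^ L) + 4 * r ^ L)"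
    by (simp add: r_def power_divide field_simps)
  also have "\<dots> \<le> q ^ L * 1" using L by (intro mult_left_mono) auto
  also have "\<dots> \<le> real (Suc L) * real K" using card_full_ge[of L] by (simp add: K_def)
  finally have K: "2 * p ^ L + 2 \<le> real K" by (simp only: mult_le_cancel_left_pos of_nat_0_less_iff zero_less_Suc)
  \<comment> \<open>The odd positions \<open>2 * j + 1\<close> are used and \<open>2 * j + 2\<close>
    must still exist: position 0 is skipped to get a positive value, and the right neighbour
    provides the gap.\<close>
  define B where "B = (K - 1) div 2"
  have "p ^ L \<le> real B"
  proof -
    have "K \<le> 2 * B + 2" unfolding B_def by linarith
    then have "real K \<le> 2 * real B + 2" by linarith
    then show ?thesis using K by linarith
  qed
  have "1 < p ^ L" using p L(1) by simp
  then have "1 < B" using \<open>p ^ L \<le> real B\<close> by linarith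
  have inj: "inj_on (wval q) (full L)"
  proof (rule inj_onI)
    fix v w assume vw: "v \<in> full L" "w \<in> full L" "wval q v = wval q w"
    show "v = w"
    proof (rule ccontr)
      assume "v \<noteq> w"
      then have "wval q v + \<delta> \<le> wval q w" using full_separated[OF vw(1,2)] vw(3) by (simp add: \<delta>_def)
      then show False using vw(3) \<delta> by simp
    qed
  qed
  define xs where "xs = sorted_list_of_set (wval q ` full L)"
  have xs: "length xs = K" "sorted_wrt (<) xs" "set xs = wval q ` full L"
    using finite_full by (simp_all add: xs_def K_def card_image[OF inj])
  define a where "a j = inv_into (full L) (wval q) (xs ! (2 * j + 1))" for j
  have in_full: "xs ! i \<in> wval q ` full L" if "i < K" for i
    using nth_mem[of i xs] xs that by simp
  have step: "xs ! i + \<delta> \<le> xs ! k" if ik: "i < k" "k < K" for i k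
  proof -
    obtain v w where vw: "v \<in> full L" "w \<in> full L" "xs ! i = wval q v" "xs ! k = wval q w"
      using in_full[of i] in_full[of k] ik by auto
    have "xs ! i < xs ! k" using xs ik by (simp add: sorted_wrt_nth_less)
    then show ?thesis using full_separated[of v L w] vw by (auto simp: \<delta>_def)
  qed
  have idx: "2 * j + 2 < K" if "j < B" for j using that unfolding B_def by linarith
  have a: "a j \<in> full L" "wval q (a j) = xs ! (2 * j + 1)" if "j < B" for j
    using in_full[of "2 * j + 1"] idx[OF that] by (auto simp: a_def inv_into_into f_inv_into_f)
  show thesis
  proof (rule that[of B L a])
    show "(q powr s) ^ L \<le> real B" using \<open>p ^ L \<le> real B\<close> by (simp add: p_def)
    show "a j \<in> full L \<and> 0 < wval q (a j) \<and> wval q (a j) + 2 * (1 / q ^ L) \<le> 1" if j: "j < B" for j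
    proof (intro conjI)
      obtain v where "xs ! 0 = wval q v" using in_full[of 0] idx[OF j] by auto
      then have "0 \<le> xs ! 0" using wval_nonneg by simp
      then show "0 < wval q (a j)" using step[of 0 "2 * j + 1"] idx[OF j] a(2)[OF j] \<delta> by simp
      obtain v where v: "v \<in> full L" "xs ! (2 * j + 2) = wval q v" using in_full idx[OF j] by blast
      then have "xs ! (2 * j + 2) + \<delta> \<le> 1" by (simp add: full_def \<delta>_def)
      then show "wval q (a j) + 2 * (1 / q ^ L) \<le> 1"
        using step[of "2 * j + 1" "2 * j + 2"] idx[OF j] a(2)[OF j] by (simp add: \<delta>_def)
    qed (use a j in simp)
    show "wval q (a i) + 2 * (1 / q ^ L) \<le> wval q (a j)" if "i < j" "j < B" for i j
      using step[of "2 * i + 1" "2 * i + 2"] step[of "2 * i + 2" "2 * j + 1"] idx[OF that(2)] that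
        a(2)[of i] a(2)[of j] by (simp add: \<delta>_def)
  qed fact+
qed

text \<open>Fullness makes the digits of \<open>g t\<close> a concatenation of blocks
  \<open>a j\<close>: reading \<open>a (d t)\<close> off \<open>g t\<close> leaves
  \<open>g (\<phi> t)\<close>. A window of \<open>2 * L\<close> digits contains a complete block,
  which is not a block of zeros since its value is positive. The set thus avoids the zeros of length
  \<open>2 * L\<close>, while \<open>g\<close> has a Hoelder inverse onto [0,1).\<close>

lemma avoiding_zeros_not_hnull:
  assumes "0 < s" "s < 1"
  shows "\<exists>m\<ge>1. \<not> hnull s (avoiding (replicate m 0))"
proof -
  obtain L B a where B: "1 < B" "0 < L" "(q powr s) ^ L \<le> real B"
    and a: "\<And>j. j < B \<Longrightarrow> a j \<in> full L \<and> 0 < wval q (a j) \<and> wval q (a j) + 2 * (1 / q ^ L) \<le> 1"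
    and gap: "\<And>i j. i < j \<Longrightarrow> j < B \<Longrightarrow> wval q (a i) + 2 * (1 / q ^ L) \<le> wval q (a j)"
    by (rule separated_full_words[OF assms]) (rule that)
  define \<eta> where "\<eta> = 1 / q ^ L"
  have \<eta>: "0 < \<eta>" "\<eta> < 1" using q1 B(2) by (auto simp: \<eta>_def)
  obtain g \<phi> :: "real \<Rightarrow> real" and d :: "real \<Rightarrow> nat" where
    g: "\<And>t. 0 \<le> t \<Longrightarrow> t < 1 \<Longrightarrow> 0 \<le> \<phi> t \<and> \<phi> t < 1 \<and> d t < B \<and>
        0 \<le> g t \<and> g t < 1 \<and> g t = wval q (a (d t)) + \<eta> * g (\<phi> t)"
    and sep: "\<And>t u n. 0 \<le> t \<Longrightarrow> t < 1 \<Longrightarrow> 0 \<le> u \<Longrightarrow> u < 1 \<Longrightarrow> 1 / real B ^ n < \<bar>t - u\<bar> \<Longrightarrow>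
        \<eta> ^ n \<le> \<bar>g t - g u\<bar>"
  proof (rule self_similar_coding[OF \<eta>, of B "\<lambda>j. wval q (a j)"])
    show "0 < B" using B by simp
    show "0 \<le> wval q (a j) \<and> wval q (a j) + 2 * \<eta> \<le> 1" if "j < B" for j
      using a[OF that] by (simp add: \<eta>_def)
    show "wval q (a i) + 2 * \<eta> \<le> wval q (a j)" if "i < j" "j < B" for i j
      using gap[OF that] by (simp add: \<eta>_def)
  qed (rule that)
  \<comment> \<open>This says \<open>B * \<eta> powr s \<ge> 1\<close>: there are enough pieces of
    ratio \<open>\<eta>\<close> to support dimension \<open>s\<close>.\<close>
  have inv_B: "1 / real B \<le> \<eta> powr s"
  proof -
    have "1 / real B \<le> 1 / (q powr s) ^ L" using B by (intro divide_left_mono) auto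
    also have "\<dots> = \<eta> powr s"
      by (simp add: \<eta>_def powr_divide powr_powr powr_power mult.commute flip: powr_realpow)
    finally show ?thesis .
  qed
  have holder: "\<bar>t - u\<bar> \<le> real B * \<bar>g t - g u\<bar> powr s" if "t \<in> {0..<1}" "u \<in> {0..<1}" for t u
  proof (rule inverse_holder[of B t u \<eta>])
    show "\<eta> ^ n \<le> \<bar>g t - g u\<bar>" if "1 / real B ^ n < \<bar>t - u\<bar>" for n
      using sep[of t u n] that \<open>t \<in> {0..<1}\<close> \<open>u \<in> {0..<1}\<close> by simp
  qed (use that \<eta> B(1) assms inv_B in auto)
  have gcyl: "g t \<in> cyl (a (d t)) (1 / q ^ L)" if "0 \<le> t" "t < 1" for t
  proof -
    have "\<eta> * g (\<phi> t) < \<eta> * 1" using g[OF that] g[of "\<phi> t"] \<eta> by (intro mult_strict_left_mono) auto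
    moreover have "0 \<le> \<eta> * g (\<phi> t)" using g[OF that] g[of "\<phi> t"] \<eta> by simp
    ultimately show ?thesis using g[OF that] by (simp add: cyl_def flip: \<eta>_def)
  qed
  have word_g: "word L (g t) = a (d t)" if "0 \<le> t" "t < 1" for t
    using full_word[OF _ gcyl[OF that]] a g[OF that] by blast
  have T_g: "(T ^^ L) (g t) = g (\<phi> t)" if "0 \<le> t" "t < 1" for t
    using g[OF that] word_g[OF that] by (simp add: Tn_eq \<eta>_def)
  have T_iter: "\<exists>u. 0 \<le> u \<and> u < 1 \<and> (T ^^ (L * i)) (g t) = g u" if "0 \<le> t" "t < 1" for t i
  proof (induction i)
    case (Suc i)
    then obtain u where u: "0 \<le> u" "u < 1" "(T ^^ (L * i)) (g t) = g u" by blast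
    have "(T ^^ (L * Suc i)) (g t) = (T ^^ L) ((T ^^ (L * i)) (g t))" by (simp add: funpow_add)
    then have "(T ^^ (L * Suc i)) (g t) = g (\<phi> u)" using T_g[OF u(1,2)] u(3) by simp
    then show ?case using g[OF u(1,2)] by blast
  qed (use that in auto)
  have "g t \<in> avoiding (replicate (2 * L) 0)" if t: "0 \<le> t" "t < 1" for t
  proof -
    have "g t \<in> J q" using g[OF t] top_pt_ge_1 by (simp add: J_eq)
    moreover have "\<not> occurs_in_greedy (replicate (2 * L) 0) (g t) q"
    proof
      assume "occurs_in_greedy (replicate (2 * L) 0) (g t) q"
      then obtain k where k: "word (2 * L) ((T ^^ k) (g t)) = replicate (2 * L) 0"
        using occurs_iff g[OF t] by auto
      have zero: "dig ((T ^^ (k + i)) (g t)) = 0" if "i < 2 * L" for i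
        using arg_cong[OF k, of "\<lambda>w. w ! i"] that by (simp add: word_Tn)
      \<comment> \<open>\<open>L * i\<close> is the first block boundary strictly after
        \<open>k\<close>. It is at most \<open>L\<close> positions away, so the block starting there
        ends within the window.\<close>
      define i where "i = Suc (k div L)"
      define e where "e = L * i - k"
      have "L * i = L * (k div L) + L" by (simp add: i_def)
      moreover have "L * (k div L) + k mod L = k" "k mod L < L" using B(2) by simp_all
      ultimately have e: "L * i = k + e" "e \<le> L" unfolding e_def by linarith+
      obtain u where u: "0 \<le> u" "u < 1" "(T ^^ (L * i)) (g t) = g u" using T_iter[OF t] by blast
      have "word L (g u) = replicate L 0"
      proof (rule nth_equalityI)
        fix j assume "j < length (word L (g u))"
        then have "j < L" by simp
        then have "dig ((T ^^ (k + (e + j))) (g t)) = 0" using e by (intro zero) simp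
        then show "word L (g u) ! j = replicate L 0 ! j"
          using \<open>j < L\<close> by (simp add: word_Tn e(1) add.assoc flip: u(3))
      qed simp
      then have "wval q (a (d u)) = 0" using word_g[OF u(1,2)] by (metis wval_zeros)
      then show False using a g[OF u(1,2)] by fastforce
    qed
    ultimately show ?thesis by simp
  qed
  then have sub: "g ` {0..<1} \<subseteq> avoiding (replicate (2 * L) 0)" by auto
  have "\<not> hnull s (avoiding (replicate (2 * L) 0))"
  proof
    assume "hnull s (avoiding (replicate (2 * L) 0))"
    then have "hnull s (g ` {0..<1})" using sub by (rule hnull_subset)
    then have "hnull 1 {0..<1::real}"
      using holder B(1) assms by (intro hnull_holder_preimage[of _ "real B" g s]) auto
    then have "{0..<1::real} \<in> null_sets lebesgue" by (rule hnull_imp_null_sets)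
    then show False by (auto simp: null_sets_def)
  qed
  then show ?thesis using B(2) by (intro exI[of _ "2 * L"]) auto
qed

section \<open>The union over all words\<close>

lemma greedy_word_zero: "greedy_word 0 q 0 m = replicate m 0"
proof -
  have "T 0 = 0" by (simp add: T_def dig_def)
  then have "(T ^^ i) 0 = 0" for i by (induction i) auto
  then show ?thesis
    by (simp add: greedy_word_eq word_def dig_def map_replicate_const)
qed

lemma hausdorff_dim_avoiding_less_1:
  assumes "0 \<le> y" "y < 1"
  shows "hausdorff_dim (avoiding (greedy_word y q l m)) < 1"
proof -
  obtain s where "0 < s" "s < 1" "hnull s (avoiding (greedy_word y q l m))"
    by (rule avoiding_hnull[OF assms, where l = l and m = m]) (rule that)
  then show ?thesis using hausdorff_dim_le by fastforce
qed

definition greedy_words :: "nat list set" where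
  "greedy_words = {greedy_word y q l m | y l m. 0 \<le> y \<and> y < 1 \<and> m \<ge> 1}"

lemma greedy_words_nonempty: "greedy_words \<noteq> {}"
proof -
  have "greedy_word 0 q 0 1 \<in> greedy_words"
    unfolding greedy_words_def by (intro CollectI exI[of _ 0] exI[of _ 1]) simp
  then show ?thesis by blast
qed

lemma countable_greedy_words: "countable greedy_words"
  by (rule countableI_type)

lemma first_category_avoiding: "first_category (\<Union>v\<in>greedy_words. avoiding v)"
proof -
  define F where "F n = avoiding (from_nat_into greedy_words n)" for n
  have "nowhere_dense (F n)" for n
    using from_nat_into[OF greedy_words_nonempty, of n] avoiding_nowhere_dense
    by (auto simp: F_def greedy_words_def)
  moreover have "(\<Union>v\<in>greedy_words. avoiding v) \<subseteq> (\<Union>n. F n)"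
  proof
    fix x assume "x \<in> (\<Union>v\<in>greedy_words. avoiding v)"
    then obtain v where v: "v \<in> greedy_words" "x \<in> avoiding v" by blast
    then obtain n where "from_nat_into greedy_words n = v"
      using from_nat_into_surj[OF countable_greedy_words] by blast
    then have "x \<in> F n" using v by (simp add: F_def)
    then show "x \<in> (\<Union>n. F n)" by blast
  qed
  ultimately show ?thesis unfolding first_category_def by blast
qed

text \<open>The exponent obtained for a word depends on the word, so it is raised to 1 before the
  countable union is taken.\<close>

lemma hnull_1_avoiding: "hnull 1 (\<Union>v\<in>greedy_words. avoiding v)"
proof (rule hnull_UN_countable[OF countable_greedy_words])
  fix v assume "v \<in> greedy_words"
  then obtain y l m where v: "v = greedy_word y q l m" "0 \<le> y" "y < 1"
    by (auto simp: greedy_words_def)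
  obtain s where "0 < s" "s < 1" "hnull s (avoiding v)"
    by (rule avoiding_hnull[OF v(2,3), where l = l and m = m, folded v(1)]) (rule that)
  then show "hnull 1 (avoiding v)" by (auto intro: hnull_mono)
qed

lemma hausdorff_dim_avoiding: "hausdorff_dim (\<Union>v\<in>greedy_words. avoiding v) = 1"
proof (rule antisym)
  show "hausdorff_dim (\<Union>v\<in>greedy_words. avoiding v) \<le> 1"
    using hausdorff_dim_le[OF _ hnull_1_avoiding] by simp
  show "1 \<le> hausdorff_dim (\<Union>v\<in>greedy_words. avoiding v)"
  proof (rule hausdorff_dim_ge[OF _ hnull_1_avoiding])
    fix r :: real assume r: "0 < r" "hnull r (\<Union>v\<in>greedy_words. avoiding v)"
    show "1 \<le> r"
    proof (rule ccontr)
      assume "\<not> 1 \<le> r"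
      then obtain m where m: "m \<ge> 1" "\<not> hnull r (avoiding (replicate m 0))"
        using avoiding_zeros_not_hnull[of r] r(1) by auto
      have "greedy_word 0 q 0 m \<in> greedy_words"
        using m(1) unfolding greedy_words_def by (intro CollectI exI[of _ 0] exI[of _ m]) simp
      then have "avoiding (replicate m 0) \<subseteq> (\<Union>v\<in>greedy_words. avoiding v)"
        unfolding greedy_word_zero by blast
      then show False using hnull_subset r(2) m(2) by blast
    qed
  qed simp
qed

end

theorem theorem2p8:
  fixes q :: real
  assumes "q > 1"
  shows "(\<forall>y l m. 0 \<le> y \<and> y < 1 \<and> m \<ge> 1 \<longrightarrow>
            hausdorff_dim {x \<in> J q. \<not> occurs_in_greedy (greedy_word y q l m) x q} < 1)
       \<and> (let Y = {x \<in> J q. \<exists>y l m. 0 \<le> y \<and> y < 1 \<and> m \<ge> 1 \<and>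
                               \<not> occurs_in_greedy (greedy_word y q l m) x q}
          in first_category Y \<and> Y \<in> null_sets lebesgue \<and> hausdorff_dim Y = 1)"
proof -
  interpret greedy_base q by unfold_locales (rule assms)
  have "{x \<in> J q. \<exists>y l m. 0 \<le> y \<and> y < 1 \<and> m \<ge> 1 \<and> \<not> occurs_in_greedy (greedy_word y q l m) x q} =
      (\<Union>v\<in>greedy_words. avoiding v)"
    unfolding greedy_words_def by blast
  then show ?thesis
    using hausdorff_dim_avoiding_less_1 first_category_avoiding hausdorff_dim_avoiding
      hnull_imp_null_sets[OF hnull_1_avoiding] by (simp add: Let_def)
qed

end
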